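(* Fix a 2-tree $T$ on $[n-1]$. The amplitude $m_T$ associated with $T$ equals $$m_T=\prod_{\{i<j<k\}}\frac{[s_{ik}]+[s_{jk}]}{[s_{ik}]\cdot[s_{jk}]},$$ where the product is over all triangles $\{i,j,k\}$, $i<j<k$, of the 2-tree $T$ on $[n-1]$ (the additional triple $\{1,2,n\}$ is not included). This rational function of degree $3-n$ is the product of $n-3$ linear forms in $H_T\,s$ divided by the product of the other $2n-6$ linear forms in $H_T\,s$.
   Context: Let $n\ge4$. Plücker coordinates. Let $$X=\begin{bmatrix}1&1&1&1&\cdots&1&0\\0&1&x_1&x_2&\cdots&x_{n-3}&1\end{bmatrix}$$ with $n$ columns and let $p_{ij}$ ($i<j$) be the $2\times2$ minor with columns $i,j$. 2-trees. A 2-tree $T$ on $[n-1]=\{1,\dots,n-1\}$ is a graph constructed as follows: start with the single edge $12$; for $k=3,4,\dots,n-1$ successively, select an edge $ij$ of the current graph (with $i,j\in\{1,\dots,k-1\}$) and add the new edges $ik$ and $jk$, called the children of $ij$. The set $\{i,j,k\}$ is then called a triangle of $T$; there are $n-3$ triangles. Descendant is the reflexive and transitive closure of the parent-child relation. For an edge $ij$ of $T$, $[s_{ij}]$ is the sum of all $s_{lm}$ with $lm\neq 12$ a descendant of $ij$ (including $ij$ itself). Scattering potential. $L_T=\sum s_{ij}\log(p_{ij})$, the sum over the $2n-6$ edges $ij\neq12$ of $T$, a function of $x\in\mathbb{C}^{n-3}$ where these $p_{ij}$ are nonzero; the $s_{ij}$ are general complex parameters. It has exactly one critical point $\hat p$,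 which depends rationally on the $s_{ij}$. $\mathrm{Hess}(L_T)$ is the determinant of the $(n-3)\times(n-3)$ Hessian matrix $\big(\partial^2L_T/\partial x_a\partial x_b\big)$. Integrand. View $T$ also as the list of $n-2$ triples consisting of its $n-3$ triangles together with the triple $\{1,2,n\}$. Let $M_T$ be the $(n-2)\times n$ matrix whose rows are the vectors $p_{jk}e_i-p_{ik}e_j+p_{ij}e_k$, one for each triple $i<j<k$ in this list. Let $\Delta(M_T)$ be the greatest common divisor of its maximal minors, a polynomial of degree $n-3$ in the Plücker coordinates such that the maximal minor of $M_T$ obtained by deleting columns $i$ and $j$ equals $\pm p_{ij}\cdot\Delta(M_T)$. The integrand is $$\mathcal{I}_T=\frac{\Delta(M_T)^2}{\prod_{ijk\in T}p_{ij}p_{ik}p_{jk}},$$ the product over all $n-2$ triples. Amplitude. $$m_T=-\frac{(\mathcal{I}_T)^2}{\mathrm{Hess}(L_T)}(\hat p),$$ where numerator and denominator are evaluated at the critical point $\hat p$. The Horn matrix $H_T$ ($3n-9$ rows, $2n-6$ columns indexed by the edges $\ne12$ of $T$). For $n=4$, $T=\{13,23\}$ (the triangle graph), columns ordered $13,23$, it is $\begin{bmatrix}1&0\\0&1\\-1&-1\end{bmatrix}$. For $k\ge4$, if $T'$ is a 2-tree on $[k]$ with last vertex $k$ connected to $i$ and $j$, and $T$ is the 2-tree on $[k-1]$ obtained by removing $k$ and the edges $ik,jk$, then $$H_{T'}=\begin{bmatrix}H_T&\mathbf{h}_{ij}&\mathbf{h}_{ij}\\ \mathbf{0}&1&0\\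 \mathbf{0}&0&1\\ \mathbf{0}&-1&-1\end{bmatrix},$$ with last two columns indexed by $ik,jk$, where $\mathbf{0}$ is the zero row vector and $\mathbf{h}_{ij}$ is the column of $H_T$ indexed by $ij$ (with $\mathbf{h}_{12}=0$). The vector $s$ is the column vector of the $2n-6$ parameters $s_{ij}$, so $H_T\,s$ is a column vector of $3n-9$ linear forms in $s$.
   Formalization: Signs are corrected: with the stated definitions m_T equals (-1)^n times the displayed product (for n=5, edges 13,23,14,24, m_T is minus the product), and m_T is minus the quotient of linear forms in H_T s (already for n=4, where the rows give s13, s23, -(s13+s23)). *)

theory Defs
  imports "HOL-Complex_Analysis.Complex_Analysis" "Jordan_Normal_Form.Determinant"
    "Jordan_Normal_Form.DL_Submatrix"
begin

section \<open>2-trees\<close>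

text \<open>An edge $ij$ with $i < j$ is the pair \<open>(i, j)\<close>.  A 2-tree is given by its construction, latest
  step first: the entry \<open>(i, j)\<close> followed by a list \<open>T\<close> says that vertex \<open>length T + 3\<close> is attached
  to the edge $ij$ of \<open>T\<close>; the empty list is the single edge $12$.  Since $i < j$ are the only
  neighbours of $k$ below $k$, the graph determines the construction (\<open>two_tree_graph_inj\<close>
  below).\<close>

type_synonym two_tree = "(nat \<times> nat) list"

text \<open>The edges different from $12$, in the order of the columns of the Horn matrix.\<close>

fun edges :: "two_tree \<Rightarrow> (nat \<times> nat) list" where
  "edges [] = []"
| "edges ((i, j) # T) = edges T @ [(i, length T + 3), (j, length T + 3)]"

fun triangles :: "two_tree \<Rightarrow> (nat \<times> nat \<times> nat) list" where
  "triangles [] = []"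
| "triangles ((i, j) # T) = triangles T @ [(i, j, length T + 3)]"

fun is_two_tree :: "two_tree \<Rightarrow> bool" where
  "is_two_tree [] \<longleftrightarrow> True"
| "is_two_tree ((i, j) # T) \<longleftrightarrow> is_two_tree T \<and> (i, j) \<in> insert (1, 2) (set (edges T))"

definition two_tree_on :: "nat \<Rightarrow> two_tree \<Rightarrow> bool" where
  "two_tree_on m T \<longleftrightarrow> is_two_tree T \<and> length T + 2 = m"

definition child_rel :: "two_tree \<Rightarrow> ((nat \<times> nat) \<times> (nat \<times> nat)) set" where
  "child_rel T = (\<Union>(i, j, k)\<in>set (triangles T). {((i, j), (i, k)), ((i, j), (j, k))})"

definition bracket :: "two_tree \<Rightarrow> (nat \<times> nat \<Rightarrow> complex) \<Rightarrow> nat \<times> nat \<Rightarrow> complex" where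
  "bracket T s e = (\<Sum>l\<in>{l \<in> set (edges T). (e, l) \<in> (child_rel T)\<^sup>*}. s l)"

lemma edges_bounds:
  "is_two_tree T \<Longrightarrow> (i, j) \<in> set (edges T) \<Longrightarrow> 1 \<le> i \<and> i < j \<and> 3 \<le> j \<and> j \<le> length T + 2"
  by (induction T arbitrary: i j rule: edges.induct) force+

lemma two_tree_graph_inj:
  assumes "is_two_tree T" "is_two_tree T'" "set (edges T) = set (edges T')"
  shows "T = T'"
  using assms
proof (induction T arbitrary: T' rule: edges.induct)
  case 1
  then show ?case by (cases T' rule: edges.cases) auto
next
  case (2 i j T)
  obtain i' j' S where T': "T' = (i', j') # S"
    using "2.prems"(3) by (cases T' rule: edges.cases) auto
  let ?m = "length T + 3" and ?m' = "length S + 3"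
  have T: "is_two_tree T" and S: "is_two_tree S" using "2.prems" T' by auto
  have bT: "\<And>a b. (a, b) \<in> set (edges T) \<Longrightarrow> b < ?m"
    and bS: "\<And>a b. (a, b) \<in> set (edges S) \<Longrightarrow> b < ?m'"
    using edges_bounds[OF T] edges_bounds[OF S] by fastforce+
  have eq: "set (edges T) \<union> {(i, ?m), (j, ?m)} = set (edges S) \<union> {(i', ?m'), (j', ?m')}"
    using "2.prems"(3) T' by auto
  have m: "?m = ?m'"
  proof (rule antisym)
    have "(i, ?m) \<in> set (edges S) \<union> {(i', ?m'), (j', ?m')}" using eq by blast
    then show "?m \<le> ?m'" using bS[of i ?m] by auto
    have "(i', ?m') \<in> set (edges T) \<union> {(i, ?m), (j, ?m)}" using eq by blast
    then show "?m' \<le> ?m" using bT[of i' ?m'] by auto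
  qed
  have ij: "i < j" using "2.prems"(1) edges_bounds[OF T, of i j] by auto
  have ij': "i' < j'" using "2.prems"(2) T' edges_bounds[OF S, of i' j'] by auto
  have nT: "\<And>a. (a, ?m) \<notin> set (edges T)" and nS: "\<And>a. (a, ?m) \<notin> set (edges S)"
    using bT bS m by fastforce+
  have iff: "\<And>a. a = i \<or> a = j \<longleftrightarrow> a = i' \<or> a = j'"
    using eq nT nS m by (metis (no_types, lifting) Un_iff insert_iff empty_iff prod.inject)
  have "i = i' \<and> j = j'" using iff ij ij' by (metis order_less_asym)
  moreover have "set (edges T) = set (edges S)"
  proof -
    have "set (edges T) \<union> {(i, ?m), (j, ?m)} = set (edges S) \<union> {(i, ?m), (j, ?m)}"
      using eq m calculation by simp
    then show ?thesis using nT nS by blast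
  qed
  then have "T = S" using "2.IH"[OF T S] by blast
  ultimately show ?case using T' by simp
qed

section \<open>Pluecker coordinates\<close>

text \<open>A point is \<open>x :: nat \<Rightarrow> complex\<close> with coordinates \<open>x 1, \<dots>, x (n - 3)\<close>; other arguments are
  irrelevant.  Vertices and columns are numbered from 1, matrix indices from 0.\<close>

definition X_mat :: "nat \<Rightarrow> (nat \<Rightarrow> complex) \<Rightarrow> complex mat" where
  "X_mat n x = mat 2 n (\<lambda>(r, c).
     if r = 0 then (if c = n - 1 then 0 else 1)
     else (if c = 0 then 0 else if c = 1 \<or> c = n - 1 then 1 else x (c - 1)))"

definition pl :: "nat \<Rightarrow> nat \<Rightarrow> nat \<Rightarrow> (nat \<Rightarrow> complex) \<Rightarrow> complex" where
  "pl n i j x = Determinant.det (mat_of_cols 2 [col (X_mat n x) (i - 1), col (X_mat n x) (j - 1)])"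

text \<open>Homogeneous polynomials of degree \<open>d\<close> in the Pluecker coordinates, as functions of the point.
  As $p_{12} = 1$, a form of degree \<open>d\<close> is also one of every higher degree, so
  \<open>pluecker_polys n\<close> is the ring of all polynomial functions in $x_1, \dots, x_{n-3}$.\<close>

inductive_set pluecker_forms :: "nat \<Rightarrow> (nat \<times> ((nat \<Rightarrow> complex) \<Rightarrow> complex)) set" for n where
  const: "(0, \<lambda>_. c) \<in> pluecker_forms n"
| coord: "1 \<le> i \<Longrightarrow> i < j \<Longrightarrow> j \<le> n \<Longrightarrow> (1, pl n i j) \<in> pluecker_forms n"
| add: "(d, f) \<in> pluecker_forms n \<Longrightarrow> (d, g) \<in> pluecker_forms n
    \<Longrightarrow> (d, \<lambda>x. f x + g x) \<in> pluecker_forms n"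
| mult: "(d, f) \<in> pluecker_forms n \<Longrightarrow> (e, g) \<in> pluecker_forms n
    \<Longrightarrow> (d + e, \<lambda>x. f x * g x) \<in> pluecker_forms n"

definition pluecker_polys :: "nat \<Rightarrow> ((nat \<Rightarrow> complex) \<Rightarrow> complex) set" where
  "pluecker_polys n = snd ` pluecker_forms n"

definition poly_dvd ::
  "nat \<Rightarrow> ((nat \<Rightarrow> complex) \<Rightarrow> complex) \<Rightarrow> ((nat \<Rightarrow> complex) \<Rightarrow> complex) \<Rightarrow> bool" where
  "poly_dvd n f g \<longleftrightarrow> (\<exists>h\<in>pluecker_polys n. g = (\<lambda>x. f x * h x))"

section \<open>Scattering potential\<close>

text \<open>The potential is multivalued.  \<open>L_pot n T s x0\<close> is a branch of it that is holomorphic near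
  \<open>x0\<close>, provided the $p_{ij}$ do not vanish at \<open>x0\<close>: there $p_{ij}(x)/p_{ij}(x_0)$ is close to 1,
  so both summands below are given by the principal logarithm without crossing its cut.  Branches
  differ by constants, so the derivatives at \<open>x0\<close> do not depend on the choice.\<close>

definition L_pot ::
  "nat \<Rightarrow> two_tree \<Rightarrow> (nat \<times> nat \<Rightarrow> complex) \<Rightarrow> (nat \<Rightarrow> complex) \<Rightarrow> (nat \<Rightarrow> complex) \<Rightarrow> complex" where
  "L_pot n T s x0 x =
     (\<Sum>(i, j)\<in>set (edges T). s (i, j) * (Ln (pl n i j x0) + Ln (pl n i j x / pl n i j x0)))"

definition partial ::
  "nat \<Rightarrow> ((nat \<Rightarrow> complex) \<Rightarrow> complex) \<Rightarrow> (nat \<Rightarrow> complex) \<Rightarrow> complex" where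
  "partial a f x = deriv (\<lambda>z. f (x(a := z))) (x a)"

text \<open>Extensionality makes points unique as functions \<open>nat \<Rightarrow> complex\<close>.\<close>

definition critical_point ::
  "nat \<Rightarrow> two_tree \<Rightarrow> (nat \<times> nat \<Rightarrow> complex) \<Rightarrow> (nat \<Rightarrow> complex) \<Rightarrow> bool" where
  "critical_point n T s x \<longleftrightarrow>
     x \<in> extensional {1..n - 3} \<and>
     (\<forall>(i, j)\<in>set (edges T). pl n i j x \<noteq> 0) \<and>
     (\<forall>a\<in>{1..n - 3}. partial a (L_pot n T s x) x = 0)"

definition hess ::
  "nat \<Rightarrow> two_tree \<Rightarrow> (nat \<times> nat \<Rightarrow> complex) \<Rightarrow> (nat \<Rightarrow> complex) \<Rightarrow> complex" where
  "hess n T s x = Determinant.det (mat (n - 3) (n - 3)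
     (\<lambda>(a, b). partial (a + 1) (partial (b + 1) (L_pot n T s x)) x))"

section \<open>Integrand and amplitude\<close>

definition triples :: "nat \<Rightarrow> two_tree \<Rightarrow> (nat \<times> nat \<times> nat) list" where
  "triples n T = triangles T @ [(1, 2, n)]"

definition M_mat :: "nat \<Rightarrow> two_tree \<Rightarrow> (nat \<Rightarrow> complex) \<Rightarrow> complex mat" where
  "M_mat n T x = mat_of_rows n (map (\<lambda>(i, j, k).
      pl n j k x \<cdot>\<^sub>v unit_vec n (i - 1) - pl n i k x \<cdot>\<^sub>v unit_vec n (j - 1)
      + pl n i j x \<cdot>\<^sub>v unit_vec n (k - 1)) (triples n T))"

definition M_minor :: "nat \<Rightarrow> two_tree \<Rightarrow> nat \<Rightarrow> nat \<Rightarrow> (nat \<Rightarrow> complex) \<Rightarrow> complex" where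
  "M_minor n T i j x = Determinant.det (submatrix (M_mat n T x) UNIV (- {i - 1, j - 1}))"

text \<open>The gcd is unique only up to a constant factor; the last condition normalises it up to sign.\<close>

definition is_Delta :: "nat \<Rightarrow> two_tree \<Rightarrow> ((nat \<Rightarrow> complex) \<Rightarrow> complex) \<Rightarrow> bool" where
  "is_Delta n T D \<longleftrightarrow>
     (n - 3, D) \<in> pluecker_forms n \<and>
     (\<forall>i j. 1 \<le> i \<and> i < j \<and> j \<le> n \<longrightarrow> poly_dvd n D (M_minor n T i j)) \<and>
     (\<forall>E\<in>pluecker_polys n.
        (\<forall>i j. 1 \<le> i \<and> i < j \<and> j \<le> n \<longrightarrow> poly_dvd n E (M_minor n T i j)) \<longrightarrow> poly_dvd n E D) \<and>
     (\<forall>i j. 1 \<le> i \<and> i < j \<and> j \<le> n \<longrightarrow>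
        (\<exists>\<sigma>\<in>{1, -1}. \<forall>x. M_minor n T i j x = \<sigma> * pl n i j x * D x))"

definition Delta :: "nat \<Rightarrow> two_tree \<Rightarrow> (nat \<Rightarrow> complex) \<Rightarrow> complex" where
  "Delta n T = (SOME D. is_Delta n T D)"

definition integrand :: "nat \<Rightarrow> two_tree \<Rightarrow> (nat \<Rightarrow> complex) \<Rightarrow> complex" where
  "integrand n T x = (Delta n T x)\<^sup>2 /
     (\<Prod>(i, j, k)\<leftarrow>triples n T. pl n i j x * pl n i k x * pl n j k x)"

text \<open>With this sign convention the amplitude is $(-1)^n$ times the product of the factors
  $([s_{ik}]+[s_{jk}])/([s_{ik}][s_{jk}])$.  For example, for $n = 5$ and the 2-tree with edges
  $13, 23, 14, 24$ the Hessian determinant is a product of two second derivatives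
  $-([s_{ik}]+[s_{jk}])^3/([s_{ik}][s_{jk}])$, and the two signs cancel.\<close>

definition amplitude :: "nat \<Rightarrow> two_tree \<Rightarrow> (nat \<times> nat \<Rightarrow> complex) \<Rightarrow> complex" where
  "amplitude n T s =
     (let p = (THE x. critical_point n T s x) in - (integrand n T p)\<^sup>2 / hess n T s p)"

text \<open>General parameters: complement of finitely many hyperplanes.\<close>

definition generic :: "two_tree \<Rightarrow> (nat \<times> nat \<Rightarrow> complex) \<Rightarrow> bool" where
  "generic T s \<longleftrightarrow> (\<forall>(i, j, k)\<in>set (triangles T).
     bracket T s (i, k) \<noteq> 0 \<and> bracket T s (j, k) \<noteq> 0 \<and>
     bracket T s (i, k) + bracket T s (j, k) \<noteq> 0)"

section \<open>Horn matrix\<close>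

definition edge_col :: "two_tree \<Rightarrow> complex mat \<Rightarrow> nat \<times> nat \<Rightarrow> complex vec" where
  "edge_col T H e = (if e = (1, 2) then 0\<^sub>v (dim_row H)
     else col H (length (takeWhile (\<lambda>f. f \<noteq> e) (edges T))))"

definition horn_base :: "complex mat" where
  "horn_base = mat_of_rows_list 2 [[1, 0], [0, 1], [-1, -1]]"

text \<open>The first equation is a dummy value, since the recursion starts at $n = 4$.\<close>

fun horn :: "two_tree \<Rightarrow> complex mat" where
  "horn [] = 0\<^sub>m 0 0"
| "horn [e] = horn_base"
| "horn (e # f # T) =
     (let H = horn (f # T); h = edge_col (f # T) H e
      in four_block_mat H (mat_of_cols (dim_row H) [h, h]) (0\<^sub>m 3 (dim_col H)) horn_base)"

definition horn_form :: "two_tree \<Rightarrow> nat \<Rightarrow> (nat \<times> nat \<Rightarrow> complex) \<Rightarrow> complex" where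
  "horn_form T r s = vec_index (horn T *\<^sub>v vec_of_list (map s (edges T))) r"

lemma length_edges [simp]: "length (edges T) = 2 * length T"
  by (induction T rule: edges.induct) auto

lemma horn_carrier: "horn T \<in> carrier_mat (3 * length T) (2 * length T)"
  by (induction T rule: horn.induct)
     (auto simp: Let_def horn_base_def mat_of_rows_list_def)

end

theory Submission
  imports Defs
begin

text \<open>
  Give vertex \<open>v\<close> of the 2-tree the coordinate \<open>y\<^sub>v\<close> of its column, so that \<open>p\<^sub>i\<^sub>j = y\<^sub>j - y\<^sub>i\<close> and
  the vertices 1 and 2 sit at 0 and 1.  The last vertex \<open>k\<close>, attached to \<open>i\<close> and \<open>j\<close>, occurs in just
  two terms of the potential.  With \<open>a = s\<^sub>i\<^sub>k\<close> and \<open>b = s\<^sub>j\<^sub>k\<close> its critical equation is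
  \<open>a / (y\<^sub>k - y\<^sub>i) + b / (y\<^sub>k - y\<^sub>j) = 0\<close>, whose only solution is the weighted mean
  \<open>(a y\<^sub>j + b y\<^sub>i) / (a + b)\<close>.  Both \<open>y\<^sub>k - y\<^sub>i\<close> and \<open>y\<^sub>k - y\<^sub>j\<close> are then constant multiples of
  \<open>y\<^sub>j - y\<^sub>i\<close>, so eliminating \<open>y\<^sub>k\<close> leaves the potential of the smaller 2-tree with
  \<open>s\<^sub>i\<^sub>j\<close> replaced by \<open>s\<^sub>i\<^sub>j + a + b\<close>.  The brackets are invariant under this contraction
  (\<open>bracket_contract\<close>), and induction on the 2-tree turns every statement about the last triangle
  into one about all triangles, with \<open>a\<close> and \<open>b\<close> replaced by \<open>[s\<^sub>i\<^sub>k]\<close> and \<open>[s\<^sub>j\<^sub>k]\<close>.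

  This yields the critical point (\<open>stationary_iff_barycentric\<close>), and also the Hessian determinant
  (\<open>det_hess_form\<close>): the Schur complement of the last diagonal entry is the Hessian matrix of the
  contracted 2-tree, so the determinant is the product over all triangles of the second derivatives
  \<open>- (a + b)\<^sup>3 / (a b (y\<^sub>j - y\<^sub>i)\<^sup>2)\<close>.

  The rows of \<open>M\<^sub>T\<close> are orthogonal to those of \<open>X\<close> by the three-term relations, and its last \<open>n - 2\<close>
  columns are lower triangular with entries \<open>p\<^sub>i\<^sub>j\<close> on the diagonal.  Hence every maximal minor is
  \<open>\<plusminus> p\<^sub>a\<^sub>b\<close> times the product of the \<open>p\<^sub>i\<^sub>j\<close> over all triangles \<open>i < j < k\<close>
  (\<open>M_minor_eq\<close>), and that product is \<open>\<Delta>\<close>.  The integrand is therefore the product of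
  \<open>p\<^sub>i\<^sub>j / (p\<^sub>i\<^sub>k p\<^sub>j\<^sub>k)\<close>; at the critical point each factor is \<open>- (a + b)\<^sup>2 / (a b p\<^sub>i\<^sub>j)\<close>, and after
  squaring and dividing by the Hessian the coordinates cancel and \<open>- (a + b) / (a b)\<close> is left for
  each triangle (\<open>amplitude_eq\<close>).

  The recursion of the Horn matrix repeats the column of \<open>ij\<close> in the columns of \<open>ik\<close> and \<open>jk\<close>, which
  is again contraction.  So its three rows for a triangle evaluate to \<open>[s\<^sub>i\<^sub>k]\<close>, \<open>[s\<^sub>j\<^sub>k]\<close> and
  \<open>- ([s\<^sub>i\<^sub>k] + [s\<^sub>j\<^sub>k])\<close> (\<open>horn_form_brackets\<close>).
\<close>

section \<open>Contracting the last triangle\<close>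

lemma two_tree_induct [consumes 1, case_names edge attach]:
  assumes "is_two_tree T"
    and "P []"
    and "\<And>i j T. is_two_tree T \<Longrightarrow> (i, j) \<in> insert (1, 2) (set (edges T)) \<Longrightarrow> 1 \<le> i \<Longrightarrow> i < j \<Longrightarrow>
      j < length T + 3 \<Longrightarrow> P T \<Longrightarrow> P ((i, j) # T)"
  shows "P T"
  using assms(1)
proof (induction T rule: is_two_tree.induct)
  case 1
  show ?case by (rule assms(2))
next
  case (2 i j T)
  then have T: "is_two_tree T" and ij: "(i, j) \<in> insert (1, 2) (set (edges T))" by auto
  have "1 \<le> i \<and> i < j \<and> j < length T + 3" using ij edges_bounds[OF T, of i j] by auto
  then show ?case using assms(3)[OF T ij] "2.IH"[OF T] by blast
qed

lemma last_edge_notin: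
  "is_two_tree T \<Longrightarrow> (a, length T + 3) \<notin> set (edges T)"
  using edges_bounds[of T a "length T + 3"] by auto

lemma root_notin_edges: "is_two_tree T \<Longrightarrow> (a, 2) \<notin> set (edges T)"
  using edges_bounds[of T a 2] by auto

lemma distinct_edges: "is_two_tree T \<Longrightarrow> distinct (edges T)"
  by (induction rule: two_tree_induct) (auto simp: last_edge_notin)

lemma length_triangles [simp]: "length (triangles T) = length T"
  by (induction T rule: triangles.induct) auto

lemma triangles_nth_last:
  "is_two_tree T \<Longrightarrow> q < length T \<Longrightarrow> snd (snd (triangles T ! q)) = q + 3"
  by (induction rule: two_tree_induct) (auto simp: nth_append less_Suc_eq)

lemma distinct_triangles: "is_two_tree T \<Longrightarrow> distinct (triangles T)"
  by (auto simp: distinct_conv_nth) (metis add_right_cancel triangles_nth_last)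

lemma triangle_bounds:
  "is_two_tree T \<Longrightarrow> (i, j, k) \<in> set (triangles T) \<Longrightarrow> 1 \<le> i \<and> i < j \<and> j < k \<and> 3 \<le> k \<and> k < length T + 3"
  by (induction rule: two_tree_induct) auto

lemma triangle_edges:
  "is_two_tree T \<Longrightarrow> (i, j, k) \<in> set (triangles T) \<Longrightarrow>
    (i, j) \<in> insert (1, 2) (set (edges T)) \<and> (i, k) \<in> set (edges T) \<and> (j, k) \<in> set (edges T)"
  by (induction rule: two_tree_induct) auto

lemma edges_attach:
  "set (edges ((i, j) # T)) = insert (i, length T + 3) (insert (j, length T + 3) (set (edges T)))"
  by auto

lemma sum_edges_attach:
  assumes "is_two_tree T" "i < j"
  shows "(\<Sum>e\<in>set (edges ((i, j) # T)). f e) =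
    (\<Sum>e\<in>set (edges T). f e) + (f (i, length T + 3) + f (j, length T + 3) :: complex)"
  unfolding edges_attach using assms last_edge_notin[OF assms(1)] by (simp add: add_ac)

text \<open>The parameters that remain after vertex \<open>k\<close> has been eliminated: the weights of its two edges are
  moved to the edge \<open>e\<close> it is attached to.\<close>

definition contract :: "nat \<times> nat \<Rightarrow> nat \<Rightarrow> (nat \<times> nat \<Rightarrow> complex) \<Rightarrow> nat \<times> nat \<Rightarrow> complex" where
  "contract e k s = s(e := s e + s (fst e, k) + s (snd e, k))"

text \<open>If \<open>e \<notin> A\<close>, the weight moved to \<open>e\<close> is lost.  This happens for the edge 12, which carries no
  parameter.\<close>

lemma sum_contract:
  assumes "finite A" "k \<notin> snd ` A"
  shows "(\<Sum>l\<in>A. contract e k s l * f l) =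
    (\<Sum>l\<in>A. s l * f l) + (if e \<in> A then (s (fst e, k) + s (snd e, k)) * f e else 0)"
proof -
  have "(\<Sum>l\<in>A. contract e k s l * f l) =
      (\<Sum>l\<in>A. s l * f l + (if l = e then (s (fst e, k) + s (snd e, k)) * f e else 0))"
    by (rule sum.cong) (auto simp: contract_def algebra_simps)
  then show ?thesis using assms(1) by (simp add: sum.distrib)
qed

lemma child_rel_attach:
  "child_rel ((i, j) # T) =
    insert ((i, j), (i, length T + 3)) (insert ((i, j), (j, length T + 3)) (child_rel T))"
  by (auto simp: child_rel_def)

lemma child_rel_bounds:
  "is_two_tree T \<Longrightarrow> (e, l) \<in> child_rel T \<Longrightarrow> snd e < length T + 3 \<and> 3 \<le> snd l"
  using triangle_bounds by (fastforce simp: child_rel_def)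

lemma descendant_of_last:
  assumes "is_two_tree T" "snd e \<ge> length T + 3"
  shows "(e, l) \<in> (child_rel T)\<^sup>* \<longleftrightarrow> l = e"
proof
  assume "(e, l) \<in> (child_rel T)\<^sup>*"
  then show "l = e"
  proof (cases rule: converse_rtranclE)
    case (step d)
    then show ?thesis using child_rel_bounds[OF assms(1), of e d] assms(2) by simp
  qed simp
qed simp

text \<open>The two new edges are leaves of the descendant relation, so they can only end a chain.\<close>

lemma descendant_attach:
  assumes "is_two_tree T" "1 \<le> i" "i < j" "j < length T + 3"
  shows "(e, l) \<in> (child_rel ((i, j) # T))\<^sup>* \<longleftrightarrow>
    (e, l) \<in> (child_rel T)\<^sup>* \<or> (e, (i, j)) \<in> (child_rel T)\<^sup>* \<and> l \<in> {(i, length T + 3), (j, length T + 3)}"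
  unfolding child_rel_attach using assms
  by (auto simp: rtrancl_insert descendant_of_last)

lemma no_ancestor_of_root:
  assumes "is_two_tree T" "(e, (1, 2)) \<in> (child_rel T)\<^sup>*"
  shows "e = (1, 2)"
  using assms(2)
proof (cases rule: rtranclE)
  case (step d)
  then show ?thesis using child_rel_bounds[OF assms(1), of d "(1, 2)"] by simp
qed simp

text \<open>The new edges descend from \<open>e\<close> exactly if \<open>ij\<close> does, so their weights may be counted as part of the
  weight of \<open>ij\<close>.  Nothing above 12 carries a parameter, so it does no harm that contraction to 12
  discards them.\<close>

lemma bracket_contract:
  assumes "is_two_tree T" "(i, j) \<in> insert (1, 2) (set (edges T))" "1 \<le> i" "i < j" "j < length T + 3"
    and "e \<in> set (edges T)"
  shows "bracket ((i, j) # T) s e = bracket T (contract (i, j) (length T + 3) s) e"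
proof -
  let ?m = "length T + 3" and ?D = "{l \<in> set (edges T). (e, l) \<in> (child_rel T)\<^sup>*}"
  have e: "snd e < ?m" "e \<noteq> (1, 2)" using edges_bounds[OF assms(1), of "fst e" "snd e"] assms(6) by auto
  have nd: "(e, (a, ?m)) \<notin> (child_rel T)\<^sup>*" for a
  proof
    assume "(e, (a, ?m)) \<in> (child_rel T)\<^sup>*"
    then obtain d where "(d, (a, ?m)) \<in> child_rel T" using e by (auto elim: rtranclE)
    then show False using triangle_bounds[OF assms(1)] by (fastforce simp: child_rel_def)
  qed
  have nm: "?m \<notin> snd ` ?D" using last_edge_notin[OF assms(1)] by force
  have "{l \<in> set (edges ((i, j) # T)). (e, l) \<in> (child_rel ((i, j) # T))\<^sup>*} =
      ?D \<union> (if (e, (i, j)) \<in> (child_rel T)\<^sup>* then {(i, ?m), (j, ?m)} else {})"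
    unfolding descendant_attach[OF assms(1,3-5)] edges_attach using nd last_edge_notin[OF assms(1)]
    by auto
  then have "bracket ((i, j) # T) s e =
      (\<Sum>l\<in>?D. s l) + (if (e, (i, j)) \<in> (child_rel T)\<^sup>* then s (i, ?m) + s (j, ?m) else 0)"
    using last_edge_notin[OF assms(1)] assms(4) by (simp add: bracket_def sum.union_disjoint)
  moreover have "(e, (i, j)) \<in> (child_rel T)\<^sup>* \<longleftrightarrow> (i, j) \<in> ?D"
    using assms(2) no_ancestor_of_root[OF assms(1), of e] e by auto
  moreover have "bracket T (contract (i, j) ?m s) e =
      (\<Sum>l\<in>?D. s l) + (if (i, j) \<in> ?D then s (i, ?m) + s (j, ?m) else 0)"
    using sum_contract[OF _ nm, of "(i, j)" s "\<lambda>_. 1"] by (simp only: bracket_def) simp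
  ultimately show ?thesis by presburger
qed

lemma bracket_last:
  assumes "is_two_tree T" "1 \<le> i" "i < j" "j < length T + 3" "a \<in> {i, j}"
  shows "bracket ((i, j) # T) s (a, length T + 3) = s (a, length T + 3)"
proof -
  let ?m = "length T + 3"
  have "((a, ?m), (i, j)) \<notin> (child_rel T)\<^sup>*"
    using descendant_of_last[OF assms(1), of "(a, ?m)"] assms(4) by auto
  then have "{l \<in> set (edges ((i, j) # T)). ((a, ?m), l) \<in> (child_rel ((i, j) # T))\<^sup>*} = {(a, ?m)}"
    unfolding descendant_attach[OF assms(1-4)] edges_attach
    using descendant_of_last[OF assms(1), of "(a, ?m)"] assms(5) by auto
  then show ?thesis by (simp add: bracket_def)
qed

lemma bracket_scale: "bracket T (\<lambda>e. t * s e) e = t * bracket T s e"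
  by (simp add: bracket_def sum_distrib_left)

lemma triangle_brackets_contract:
  assumes "is_two_tree T" "(i, j) \<in> insert (1, 2) (set (edges T))" "1 \<le> i" "i < j" "j < length T + 3"
    and "(a, b, c) \<in> set (triangles T)"
  shows "bracket ((i, j) # T) s (a, c) = bracket T (contract (i, j) (length T + 3) s) (a, c)"
    and "bracket ((i, j) # T) s (b, c) = bracket T (contract (i, j) (length T + 3) s) (b, c)"
  using triangle_edges[OF assms(1,6)] bracket_contract[OF assms(1-5)] by auto

lemma generic_attach:
  assumes "is_two_tree T" "(i, j) \<in> insert (1, 2) (set (edges T))" "1 \<le> i" "i < j" "j < length T + 3"
  shows "generic ((i, j) # T) s \<longleftrightarrow> generic T (contract (i, j) (length T + 3) s) \<and>
    s (i, length T + 3) \<noteq> 0 \<and> s (j, length T + 3) \<noteq> 0 \<and> s (i, length T + 3) + s (j, length T + 3) \<noteq> 0"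
  using triangle_brackets_contract[OF assms, of _ _ _ s] bracket_last[OF assms(1,3-5), of _ s]
  by (auto simp: generic_def)

section \<open>The greatest common divisor of the maximal minors\<close>

text \<open>The coordinate of a vertex, that is, the second entry of its column of \<open>X\<close>.\<close>

definition position :: "(nat \<Rightarrow> complex) \<Rightarrow> nat \<Rightarrow> complex" where
  "position x v = (if v = 1 then 0 else if v = 2 then 1 else x (v - 2))"

lemma det_mat_2:
  assumes "A \<in> carrier_mat 2 2"
  shows "Determinant.det A = A $$ (0, 0) * A $$ (1, 1) - A $$ (0, 1) * (A $$ (1, 0) :: complex)"
proof -
  have A: "mat_delete A 0 0 \<in> carrier_mat 1 1" "mat_delete A 0 1 \<in> carrier_mat 1 1"
    using mat_delete_carrier[of A 1 1] assms by (auto simp: numeral_2_eq_2)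
  have "Determinant.det A = (\<Sum>c<2. A $$ (0, c) * cofactor A 0 c)"
    by (rule laplace_expansion_row[OF assms]) simp
  then show ?thesis
    using A assms by (simp add: numeral_2_eq_2 cofactor_def det_single mat_delete_def)
qed

lemma X_mat_carrier [simp]: "X_mat n x \<in> carrier_mat 2 n"
  "dim_row (X_mat n x) = 2" "dim_col (X_mat n x) = n"
  by (auto simp: X_mat_def)

lemma pl_conv:
  assumes "1 \<le> i" "i \<le> n" "1 \<le> j" "j \<le> n"
  shows "pl n i j x = X_mat n x $$ (0, i - 1) * X_mat n x $$ (1, j - 1)
    - X_mat n x $$ (0, j - 1) * X_mat n x $$ (1, i - 1)"
proof -
  have "mat_of_cols 2 [col (X_mat n x) (i - 1), col (X_mat n x) (j - 1)] \<in> carrier_mat 2 2"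
    by auto
  from det_mat_2[OF this] show ?thesis using assms
    by (simp add: pl_def mat_of_cols_index)
qed

lemma X_mat_entries:
  assumes "c < n" "2 \<le> n"
  shows "X_mat n x $$ (0, c) = (if c = n - 1 then 0 else 1)"
    "X_mat n x $$ (Suc 0, c) = (if c = n - 1 then 1 else position x (Suc c))"
  using assms by (auto simp: X_mat_def position_def)

lemma pl_finite:
  assumes "1 \<le> i" "i < j" "j < n"
  shows "pl n i j x = position x j - position x i"
proof -
  have "j - Suc 0 \<noteq> n - Suc 0" "i - Suc 0 \<noteq> n - Suc 0" using assms by auto
  then show ?thesis using assms pl_conv[of i n j x] by (simp add: X_mat_entries)
qed

lemma pl_infinity:
  assumes "1 \<le> i" "i < n"
  shows "pl n i n x = 1"
  using assms pl_conv[of i n n x] by (simp add: X_mat_entries)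

text \<open>Skipping first \<open>a\<close> and then \<open>b\<close> enumerates the complement of \<open>{a, b}\<close> in increasing order.  For
  \<open>a < b\<close> this is what deleting column \<open>b\<close> and then column \<open>a\<close> does.\<close>

lemma card_below_of_complement_pair:
  fixes a b c :: nat
  assumes "a < b"
  defines "v \<equiv> insert_index b (insert_index a c)"
  shows "v \<in> - {a, b}" "card {u \<in> - {a, b}. u < v} = c"
proof -
  show "v \<in> - {a, b}" using assms by (auto simp: insert_index_def)
  have "{u \<in> - {a, b}. u < v} = {..<v} - {a, b}" by auto
  moreover have "card ({..<v} - {a, b}) = c"
  proof (cases "c < a")
    case True
    then have "v = c" using assms by (auto simp: insert_index_def)
    then have "{..<v} - {a, b} = {..<c}" using True assms by auto
    then show ?thesis by simp
  next
    case a: False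
    show ?thesis
    proof (cases "Suc c < b")
      case True
      then have "v = Suc c" using assms a by (auto simp: insert_index_def)
      then have "{..<v} - {a, b} = {..<Suc c} - {a}" using True by auto
      then show ?thesis using a by simp
    next
      case False
      then have v: "v = Suc (Suc c)" using assms a by (auto simp: insert_index_def)
      then have "{a, b} \<subseteq> {..<v}" using False assms(1) a by auto
      then show ?thesis using v assms(1) by (simp add: card_Diff_subset)
    qed
  qed
  ultimately show "card {u \<in> - {a, b}. u < v} = c" by simp
qed

lemma pick_complement_pair:
  assumes "a < b"
  shows "pick (- {a, b}) c = insert_index b (insert_index a c)"
  using pick_card_in_set[OF card_below_of_complement_pair(1)[OF assms, of c]]
  unfolding card_below_of_complement_pair(2)[OF assms] .

lemma mat_delete_entry:
  assumes "A \<in> carrier_mat (Suc m) (Suc m)" "r < m" "c < m"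
  shows "mat_delete A p q $$ (r, c) = A $$ (insert_index p r, insert_index q c)"
  using assms by (auto simp: mat_delete_def insert_index_def)

lemma det_unit_row:
  fixes A :: "complex mat"
  assumes "A \<in> carrier_mat n n" "p < n" "q < n"
    and "\<And>c. c < n \<Longrightarrow> A $$ (p, c) = (if c = q then 1 else 0)"
  shows "Determinant.det A = (- 1) ^ (p + q) * Determinant.det (mat_delete A p q)"
proof -
  have "Determinant.det A = (\<Sum>c<n. A $$ (p, c) * cofactor A p c)"
    by (rule laplace_expansion_row[OF assms(1,2)])
  also have "\<dots> = (\<Sum>c<n. if c = q then cofactor A p q else 0)"
    by (rule sum.cong) (auto simp: assms(4))
  finally show ?thesis using assms(3) by (simp add: cofactor_def)
qed

lemma sign_cases: "(- 1 :: complex) ^ m \<in> {1, - 1}"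
  using minus_one_power_iff[of m, where 'a = complex] by (auto split: if_splits)

text \<open>A maximal minor of a matrix with two more columns than rows is a full determinant: two unit rows
  placed on top remove the deleted columns by Laplace expansion.\<close>

lemma det_unit_rows_on_top:
  fixes A :: "complex mat"
  assumes A: "A \<in> carrier_mat m (Suc (Suc m))" and ab: "a < b" "b < Suc (Suc m)"
  defines "Y \<equiv> mat (Suc (Suc m)) (Suc (Suc m)) (\<lambda>(r, c). if r = 0 then (if c = a then 1 else 0)
      else if r = 1 then (if c = b then 1 else 0) else A $$ (r - 2, c))"
  shows "Determinant.det (submatrix A UNIV (- {a, b})) = (- 1) ^ (1 + b + a) * Determinant.det Y"
proof -
  have Y: "Y \<in> carrier_mat (Suc (Suc m)) (Suc (Suc m))" by (simp add: Y_def)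
  define Y1 where "Y1 = mat_delete Y 1 b"
  have Y1: "Y1 \<in> carrier_mat (Suc m) (Suc m)" using mat_delete_carrier[OF Y] by (simp add: Y1_def)
  have Y1_entry: "Y1 $$ (r, c) = Y $$ (insert_index 1 r, insert_index b c)" if "r < Suc m" "c < Suc m" for r c
    using mat_delete_entry[OF Y that] by (simp add: Y1_def)
  have d1: "Determinant.det Y = (- 1) ^ (1 + b) * Determinant.det Y1"
    unfolding Y1_def by (rule det_unit_row[OF Y]) (use ab in \<open>auto simp: Y_def\<close>)
  have d2: "Determinant.det Y1 = (- 1) ^ (0 + a) * Determinant.det (mat_delete Y1 0 a)"
    by (rule det_unit_row[OF Y1]) (use ab in \<open>auto simp: Y1_entry Y_def insert_index_def\<close>)
  have card: "card {j. j < Suc (Suc m) \<and> j \<in> - {a, b}} = m"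
  proof -
    have "{j. j < Suc (Suc m) \<and> j \<in> - {a, b}} = {..<Suc (Suc m)} - {a, b}" by auto
    then show ?thesis using ab by (simp add: card_Diff_subset)
  qed
  have "submatrix A UNIV (- {a, b}) = mat_delete Y1 0 a"
  proof (rule eq_matI)
    show "dim_row (submatrix A UNIV (- {a, b})) = dim_row (mat_delete Y1 0 a)"
      "dim_col (submatrix A UNIV (- {a, b})) = dim_col (mat_delete Y1 0 a)"
      using A Y1 card by (auto simp: dim_submatrix)
  next
    fix r c assume "r < dim_row (mat_delete Y1 0 a)" "c < dim_col (mat_delete Y1 0 a)"
    then have rc: "r < m" "c < m" using Y1 by auto
    have "submatrix A UNIV (- {a, b}) $$ (r, c) = A $$ (r, insert_index b (insert_index a c))"
      using submatrix_index[of r A UNIV c "- {a, b}"] A rc card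
      by (simp add: pick_UNIV pick_complement_pair[OF ab(1)])
    moreover have "mat_delete Y1 0 a $$ (r, c) = A $$ (r, insert_index b (insert_index a c))"
      using rc ab by (simp add: mat_delete_entry[OF Y1] Y1_entry Y_def insert_index_def)
    ultimately show "submatrix A UNIV (- {a, b}) $$ (r, c) = mat_delete Y1 0 a $$ (r, c)" by simp
  qed
  then show ?thesis
    using d1 d2 sign_cases[of a] sign_cases[of b] by (auto simp: power_add)
qed

text \<open>The extra triple \<open>{1, 2, n}\<close> follows the pattern of the triangles: in row \<open>r\<close> the largest index is
  \<open>r + 3\<close>.\<close>

lemma triples_nth:
  assumes "is_two_tree T" "n = length T + 3" "r < n - 2"
  obtains i j where "triples n T ! r = (i, j, r + 3)" "1 \<le> i" "i < j" "j < r + 3"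
proof (cases "r < length T")
  case True
  obtain i j k where ijk: "triangles T ! r = (i, j, k)" by (cases "triangles T ! r")
  then have "(i, j, k) \<in> set (triangles T)" using True by (metis length_triangles nth_mem)
  with ijk True show ?thesis
    using triangle_bounds[OF assms(1), of i j k] triangles_nth_last[OF assms(1), of r] that[of i j]
    by (auto simp: triples_def nth_append)
next
  case False
  then show ?thesis using assms that[of 1 2] by (auto simp: triples_def nth_append)
qed

lemma M_mat_carrier: "M_mat n T x \<in> carrier_mat (Suc (length T)) n"
  by (auto simp: M_mat_def triples_def mat_of_rows_def)

lemma M_mat_entry:
  assumes "triples n T ! r = (i, j, k)" "r < Suc (length T)" "c < n" "i \<ge> 1" "j \<ge> 1" "k \<ge> 1"
    "i \<le> n" "j \<le> n" "k \<le> n"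
  shows "M_mat n T x $$ (r, c) = pl n j k x * (if c = i - 1 then 1 else 0)
    - pl n i k x * (if c = j - 1 then 1 else 0) + pl n i j x * (if c = k - 1 then 1 else 0)"
proof -
  have "length (triples n T) = Suc (length T)" by (simp add: triples_def)
  then show ?thesis using assms by (simp add: M_mat_def mat_of_rows_index)
qed

text \<open>The sum has three terms, and it is the relation \<open>p\<^sub>j\<^sub>k x\<^sub>i - p\<^sub>i\<^sub>k x\<^sub>j + p\<^sub>i\<^sub>j x\<^sub>k = 0\<close> between three
  vectors of the plane, read off one coordinate at a time.\<close>

lemma M_mat_orthogonal_X_mat:
  assumes "is_two_tree T" "n = length T + 3" "r < n - 2" "q < 2"
  shows "(\<Sum>c<n. M_mat n T x $$ (r, c) * X_mat n x $$ (q, c)) = 0"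
proof -
  obtain i j where t: "triples n T ! r = (i, j, r + 3)" "1 \<le> i" "i < j" "j < r + 3"
    using triples_nth[OF assms(1-3)] by metis
  let ?X = "X_mat n x"
  have le: "i \<le> n" "j \<le> n" "r + 3 \<le> n" "1 \<le> j" "1 \<le> r + 3"
    "i - 1 < n" "j - 1 < n" "r + 2 < n" using t assms by auto
  have "(\<Sum>c<n. M_mat n T x $$ (r, c) * ?X $$ (q, c)) =
      (\<Sum>c<n. pl n j (r + 3) x * (if c = i - 1 then ?X $$ (q, c) else 0)
        - pl n i (r + 3) x * (if c = j - 1 then ?X $$ (q, c) else 0)
        + pl n i j x * (if c = r + 2 then ?X $$ (q, c) else 0))"
    by (rule sum.cong[OF refl], subst M_mat_entry[OF t(1)])
      (use t assms le in \<open>auto simp: algebra_simps\<close>)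
  also have "\<dots> = pl n j (r + 3) x * ?X $$ (q, i - 1) - pl n i (r + 3) x * ?X $$ (q, j - 1)
      + pl n i j x * ?X $$ (q, r + 2)"
    using t le assms(3) by (simp add: sum.distrib sum_subtractf sum.delta flip: sum_distrib_left)
  also have "\<dots> = 0"
  proof -
    have "q = 0 \<or> q = 1" using assms(4) by auto
    then show ?thesis
      using t(2) le by (auto simp: pl_conv algebra_simps)
  qed
  finally show ?thesis .
qed

definition apex_prod :: "nat \<Rightarrow> two_tree \<Rightarrow> (nat \<Rightarrow> complex) \<Rightarrow> complex" where
  "apex_prod n T x = (\<Prod>(i, j, k)\<leftarrow>triangles T. pl n i j x)"

text \<open>Row \<open>r\<close> of the block ends on the diagonal, with the entry \<open>p\<^sub>i\<^sub>j\<close> belonging to the largest index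
  \<open>r + 3\<close>.  The last row contributes \<open>p\<^sub>1\<^sub>2 = 1\<close>.\<close>

lemma det_M_mat_right_block:
  assumes "is_two_tree T" "n = length T + 3"
  shows "Determinant.det (mat (n - 2) (n - 2) (\<lambda>(r, c). M_mat n T x $$ (r, c + 2))) = apex_prod n T x"
proof -
  let ?L = "mat (n - 2) (n - 2) (\<lambda>(r, c). M_mat n T x $$ (r, c + 2))"
  have len: "n - 2 = length (triples n T)" "n - 2 = Suc (length T)" using assms(2) by (auto simp: triples_def)
  have entry: "?L $$ (r, c) = (if c = r then (case triples n T ! r of (i, j, k) \<Rightarrow> pl n i j x) else 0)"
    if rc: "r \<le> c" "c < n - 2" for r c
  proof -
    have r: "r < n - 2" using rc by simp
    obtain i j where t: "triples n T ! r = (i, j, r + 3)" "1 \<le> i" "i < j" "j < r + 3"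
      using triples_nth[OF assms r] by metis
    have "M_mat n T x $$ (r, c + 2) = pl n j (r + 3) x * (if c + 2 = i - 1 then 1 else 0)
        - pl n i (r + 3) x * (if c + 2 = j - 1 then 1 else 0)
        + pl n i j x * (if c + 2 = r + 3 - 1 then 1 else 0)"
      by (rule M_mat_entry[OF t(1)]) (use t(2-) rc assms(2) in auto)
    then show ?thesis using t rc by auto
  qed
  have "Determinant.det ?L = prod_list (diag_mat ?L)"
  proof (rule det_lower_triangular[of "n - 2"])
    fix r c assume "r < c" "c < n - 2"
    then show "?L $$ (r, c) = 0" using entry[of r c] by simp
  qed simp
  also have "diag_mat ?L = map (\<lambda>(i, j, k). pl n i j x) (triples n T)"
    by (rule nth_equalityI) (use entry[OF order.refl] in \<open>auto simp: diag_mat_def len(1)\<close>)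
  also have "prod_list \<dots> = apex_prod n T x"
    using assms by (simp add: triples_def apex_prod_def pl_finite position_def)
  finally show ?thesis .
qed

text \<open>Let \<open>Y\<close> be \<open>M\<^sub>T\<close> below the unit rows for columns \<open>a\<close> and \<open>b\<close>, and let \<open>W\<close> consist of the columns
  of the transpose of \<open>X\<close> and the last \<open>n - 2\<close> unit columns.  Orthogonality makes \<open>Y W\<close> block upper
  triangular: its first block contains columns \<open>a\<close> and \<open>b\<close> of \<open>X\<close> and has determinant \<open>p\<^sub>a\<^sub>b\<close>, its
  second block is the triangular one, and \<open>W\<close> has determinant \<open>p\<^sub>1\<^sub>2 = 1\<close>.  The sign does not
  depend on \<open>x\<close>, so the equation is one of polynomials.\<close>

lemma M_minor_eq:
  assumes T: "is_two_tree T" and n: "n = length T + 3" and ab: "1 \<le> a" "a < b" "b \<le> n"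
  shows "M_minor n T a b x = (- 1) ^ (1 + (b - 1) + (a - 1)) * pl n a b x * apex_prod n T x"
proof -
  define m where "m = Suc (length T)"
  have nm: "n = Suc (Suc m)" "n - 2 = m" using n by (auto simp: m_def)
  let ?M = "M_mat n T x" and ?X = "X_mat n x"
  define Y where "Y = mat n n (\<lambda>(r, c). if r = 0 then (if c = a - 1 then 1 else 0)
      else if r = 1 then (if c = b - 1 then 1 else 0) else ?M $$ (r - 2, c))"
  have minor: "M_minor n T a b x = (- 1) ^ (1 + (b - 1) + (a - 1)) * Determinant.det Y"
    using det_unit_rows_on_top[of ?M m "a - 1" "b - 1"] M_mat_carrier[of n T x] ab nm
    unfolding M_minor_def Y_def m_def by auto
  define W where "W = four_block_mat (mat 2 2 (\<lambda>(r, c). ?X $$ (c, r))) (0\<^sub>m 2 m)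
      (mat m 2 (\<lambda>(r, c). ?X $$ (c, r + 2))) (1\<^sub>m m)"
  have W_carrier: "W \<in> carrier_mat n n" using nm by (auto simp: W_def)
  have W_entry: "W $$ (r, c) = (if c < 2 then ?X $$ (c, r) else if r = c then 1 else 0)"
    if "r < n" "c < n" for r c
  proof (cases "r < 2")
    case False
    then have "Suc (Suc (r - 2)) = r" by simp
    then show ?thesis using that nm False by (auto simp: W_def)
  qed (use that nm in \<open>auto simp: W_def\<close>)
  have det_W: "Determinant.det W = 1"
  proof -
    have "Determinant.det W = Determinant.det (mat 2 2 (\<lambda>(r, c). ?X $$ (c, r))) * Determinant.det (1\<^sub>m m)"
      unfolding W_def by (rule det_four_block_mat_upper_right_zero) auto
    then show ?thesis using nm n by (simp add: det_mat_2 X_mat_entries position_def)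
  qed
  have YW_entry: "(Y * W) $$ (r, c) = (\<Sum>d<n. Y $$ (r, d) * W $$ (d, c))" if "r < n" "c < n" for r c
    using that W_carrier by (auto simp: Y_def scalar_prod_def atLeast0LessThan intro!: sum.cong)
  have YW_right: "(Y * W) $$ (r, c) = Y $$ (r, c)" if "r < n" "2 \<le> c" "c < n" for r c
  proof -
    have "(Y * W) $$ (r, c) = (\<Sum>d<n. if d = c then Y $$ (r, c) else 0)"
      unfolding YW_entry[OF that(1,3)] by (rule sum.cong) (use that in \<open>auto simp: W_entry\<close>)
    then show ?thesis using that by simp
  qed
  have YW_left: "(Y * W) $$ (r, c) = (\<Sum>d<n. Y $$ (r, d) * ?X $$ (c, d))" if "r < n" "c < 2" for r c
  proof -
    have "c < n" using that nm by simp
    then show ?thesis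
      using that by (auto simp: YW_entry W_entry intro!: sum.cong)
  qed
  let ?P = "mat 2 2 (\<lambda>(r, c). ?X $$ (c, if r = 0 then a - 1 else b - 1))"
  have "Y * W = four_block_mat ?P (mat 2 m (\<lambda>(r, c). Y $$ (r, c + 2))) (0\<^sub>m m 2)
      (mat m m (\<lambda>(r, c). ?M $$ (r, c + 2)))" (is "_ = ?B")
  proof (rule eq_matI)
    show "dim_row (Y * W) = dim_row ?B" "dim_col (Y * W) = dim_col ?B"
      using W_carrier nm by (auto simp: Y_def)
    fix r c assume "r < dim_row ?B" "c < dim_col ?B"
    then have rc: "r < n" "c < n" using nm by auto
    show "(Y * W) $$ (r, c) = ?B $$ (r, c)"
    proof (cases "c < 2")
      case False
      then have "Suc (Suc (c - 2)) = c" by simp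
      then have "?B $$ (r, c) = Y $$ (r, c)"
        using rc nm False by (cases "r < 2") (simp_all add: Y_def)
      then show ?thesis using rc False by (simp add: YW_right)
    next
      case c: True
      show ?thesis
      proof (cases "r < 2")
        case True
        have "(\<Sum>d<n. Y $$ (r, d) * ?X $$ (c, d)) =
            (\<Sum>d<n. if d = (if r = 0 then a - 1 else b - 1) then ?X $$ (c, d) else 0)"
          by (rule sum.cong) (use True rc in \<open>auto simp: Y_def\<close>)
        then show ?thesis using True c rc ab by (auto simp: YW_left)
      next
        case False
        have "(\<Sum>d<n. Y $$ (r, d) * ?X $$ (c, d)) = (\<Sum>d<n. ?M $$ (r - 2, d) * ?X $$ (c, d))"
          by (rule sum.cong) (use False rc in \<open>auto simp: Y_def\<close>)
        also have "\<dots> = 0" by (rule M_mat_orthogonal_X_mat[OF T n]) (use False rc c in auto)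
        finally show ?thesis using False c rc nm by (simp add: YW_left)
      qed
    qed
  qed
  then have "Determinant.det (Y * W) = Determinant.det ?P * Determinant.det (mat m m (\<lambda>(r, c). ?M $$ (r, c + 2)))"
    by (simp add: det_four_block_mat_lower_left_zero[where n = 2 and m = m])
  moreover have "Determinant.det (Y * W) = Determinant.det Y"
    using det_mult[of Y n W] W_carrier det_W by (simp add: Y_def)
  moreover have "Determinant.det ?P = pl n a b x"
    using ab by (simp add: det_mat_2 pl_conv algebra_simps)
  ultimately have "Determinant.det Y = pl n a b x * apex_prod n T x"
    using det_M_mat_right_block[OF T n, of x] by (simp add: nm)
  then show ?thesis using minor by (simp add: mult.assoc)
qed

lemma apex_prod_form:
  assumes "is_two_tree T" "length T + 3 \<le> n"
  shows "(length T, apex_prod n T) \<in> pluecker_forms n"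
  using assms
proof (induction rule: two_tree_induct)
  case edge
  then show ?case using pluecker_forms.const[of 1 n] by (simp add: apex_prod_def[abs_def])
next
  case (attach i j T)
  have "(length T + 1, \<lambda>x. apex_prod n T x * pl n i j x) \<in> pluecker_forms n"
    using attach by (intro pluecker_forms.mult pluecker_forms.coord) auto
  then show ?case by (simp add: apex_prod_def[abs_def])
qed

lemma pluecker_polys_scale:
  "f \<in> pluecker_polys n \<Longrightarrow> (\<lambda>x. c * f x) \<in> pluecker_polys n"
  using pluecker_forms.mult[OF pluecker_forms.const] by (force simp: pluecker_polys_def)

text \<open>For the column pair \<open>{1, n}\<close> the factor \<open>p\<^sub>1\<^sub>n\<close> is 1, so this minor is the product itself up to sign
  and every common divisor of the minors divides it.\<close>

lemma is_Delta_apex_prod: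
  assumes T: "is_two_tree T" and n: "n = length T + 3"
  shows "is_Delta n T (apex_prod n T)"
  unfolding is_Delta_def
proof (intro conjI ballI allI impI)
  show "(n - 3, apex_prod n T) \<in> pluecker_forms n" using apex_prod_form[OF T, of n] n by simp
next
  fix i j assume ij: "1 \<le> i \<and> i < j \<and> j \<le> n"
  have "(\<lambda>x. (- 1) ^ (1 + (j - 1) + (i - 1)) * pl n i j x) \<in> pluecker_polys n"
    using pluecker_forms.coord[of i j n] ij
    by (intro pluecker_polys_scale) (force simp: pluecker_polys_def)
  then show "poly_dvd n (apex_prod n T) (M_minor n T i j)"
    unfolding poly_dvd_def using ij by (force simp: M_minor_eq[OF T n] mult_ac)
  show "\<exists>\<sigma>\<in>{1, - 1}. \<forall>x. M_minor n T i j x = \<sigma> * pl n i j x * apex_prod n T x"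
    using ij M_minor_eq[OF T n] sign_cases by blast
next
  fix E assume "\<forall>i j. 1 \<le> i \<and> i < j \<and> j \<le> n \<longrightarrow> poly_dvd n E (M_minor n T i j)"
  then have "poly_dvd n E (M_minor n T 1 n)" using n by auto
  then obtain h where h: "h \<in> pluecker_polys n" "M_minor n T 1 n = (\<lambda>x. E x * h x)"
    by (auto simp: poly_dvd_def)
  define \<sigma> :: complex where "\<sigma> = (- 1) ^ (1 + (n - 1) + (1 - 1))"
  have \<sigma>: "\<sigma> * \<sigma> = 1" using sign_cases[of "1 + (n - 1) + (1 - 1)"] by (auto simp: \<sigma>_def)
  have "M_minor n T 1 n x = \<sigma> * apex_prod n T x" for x
    using M_minor_eq[OF T n, of 1 n x] n by (simp add: pl_infinity \<sigma>_def)
  then have "apex_prod n T x = E x * (\<sigma> * h x)" for x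
    using fun_cong[OF h(2), of x] \<sigma> by (metis mult.assoc mult.left_commute mult_1)
  then show "poly_dvd n E (apex_prod n T)"
    unfolding poly_dvd_def by (intro bexI[OF _ pluecker_polys_scale[OF h(1), of \<sigma>]] ext)
qed

text \<open>The minor for columns 1 and \<open>n\<close> determines \<open>\<Delta>\<close> up to sign, so the square does not depend on
  which greatest common divisor is chosen.\<close>

lemma Delta_square:
  assumes T: "is_two_tree T" and n: "n = length T + 3"
  shows "(Delta n T x)\<^sup>2 = (apex_prod n T x)\<^sup>2"
proof -
  have "is_Delta n T (Delta n T)"
    unfolding Delta_def by (rule someI[of "is_Delta n T"]) (rule is_Delta_apex_prod[OF T n])
  then obtain \<sigma> where \<sigma>: "\<sigma> \<in> {1, - 1}" "M_minor n T 1 n x = \<sigma> * pl n 1 n x * Delta n T x"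
    unfolding is_Delta_def using n by (metis One_nat_def le_refl less_add_same_cancel1 numeral_3_eq_3 add.commute le_add2 plus_1_eq_Suc add_Suc_right zero_less_Suc)
  then have "(M_minor n T 1 n x)\<^sup>2 = (Delta n T x)\<^sup>2"
    using n by (auto simp: pl_infinity)
  moreover have "(M_minor n T 1 n x)\<^sup>2 = (apex_prod n T x)\<^sup>2"
  proof -
    obtain c where "c \<in> {1, - 1}" "M_minor n T 1 n x = c * pl n 1 n x * apex_prod n T x"
      by (rule that[OF sign_cases M_minor_eq[OF T n]]) (use n in auto)
    then show ?thesis using n by (auto simp: pl_infinity)
  qed
  ultimately show ?thesis by simp
qed

section \<open>Critical points\<close>

definition incidence :: "nat \<Rightarrow> nat \<times> nat \<Rightarrow> complex" where
  "incidence k e = (if snd e = k then 1 else 0) - (if fst e = k then 1 else 0)"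

definition gap :: "(nat \<Rightarrow> complex) \<Rightarrow> nat \<times> nat \<Rightarrow> complex" where
  "gap v e = v (snd e) - v (fst e)"

text \<open>The gradient and the Hessian matrix of the potential as rational functions of the coordinates of
  the vertices, with rows and columns indexed by vertices.  They make sense for any \<open>v\<close>, which
  is what the induction over 2-trees needs.\<close>

definition grad_form :: "two_tree \<Rightarrow> (nat \<times> nat \<Rightarrow> complex) \<Rightarrow> (nat \<Rightarrow> complex) \<Rightarrow> nat \<Rightarrow> complex" where
  "grad_form T s v k = (\<Sum>e\<in>set (edges T). s e * (incidence k e / gap v e))"

definition hess_form ::
  "two_tree \<Rightarrow> (nat \<times> nat \<Rightarrow> complex) \<Rightarrow> (nat \<Rightarrow> complex) \<Rightarrow> nat \<Rightarrow> nat \<Rightarrow> complex" where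
  "hess_form T s v k l = (\<Sum>e\<in>set (edges T). s e * (- incidence k e * incidence l e / (gap v e)\<^sup>2))"

definition stationary :: "two_tree \<Rightarrow> (nat \<times> nat \<Rightarrow> complex) \<Rightarrow> (nat \<Rightarrow> complex) \<Rightarrow> bool" where
  "stationary T s v \<longleftrightarrow> (\<forall>e\<in>set (edges T). gap v e \<noteq> 0) \<and>
     (\<forall>k. 3 \<le> k \<and> k < length T + 3 \<longrightarrow> grad_form T s v k = 0)"

text \<open>Every vertex is the weighted mean of the two vertices it is attached to, with denominators
  cleared.\<close>

definition barycentric :: "two_tree \<Rightarrow> (nat \<times> nat \<Rightarrow> complex) \<Rightarrow> (nat \<Rightarrow> complex) \<Rightarrow> bool" where
  "barycentric T s v \<longleftrightarrow> (\<forall>(i, j, k)\<in>set (triangles T).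
     (bracket T s (i, k) + bracket T s (j, k)) * v k = bracket T s (i, k) * v j + bracket T s (j, k) * v i)"

lemma gap_pair [simp]: "gap v (i, j) = v j - v i"
  by (simp add: gap_def)

lemma incidence_beyond:
  assumes "is_two_tree T" "e \<in> set (edges T)" "length T + 3 \<le> k"
  shows "incidence k e = 0"
  using edges_bounds[OF assms(1), of "fst e" "snd e"] assms(2,3) by (auto simp: incidence_def)

text \<open>The side condition for the edge 12 holds for the summands of \<open>grad_form\<close> and \<open>hess_form\<close>, since the
  vertices 1 and 2 are fixed.\<close>

lemma sum_edges_contract:
  assumes "is_two_tree T" "(i, j) \<in> insert (1, 2) (set (edges T))" "(i, j) = (1, 2) \<Longrightarrow> f (i, j) = 0"
  shows "(\<Sum>e\<in>set (edges T). contract (i, j) (length T + 3) s e * f e) =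
    (\<Sum>e\<in>set (edges T). s e * f e) + (s (i, length T + 3) + s (j, length T + 3)) * f (i, j)"
proof -
  have "length T + 3 \<notin> snd ` set (edges T)" using last_edge_notin[OF assms(1)] by force
  then show ?thesis
    using sum_contract[of "set (edges T)" "length T + 3" "(i, j)" s f] assms(2,3) by auto
qed

lemma barycentric_attach:
  assumes "is_two_tree T" "(i, j) \<in> insert (1, 2) (set (edges T))" "1 \<le> i" "i < j" "j < length T + 3"
  shows "barycentric ((i, j) # T) s v \<longleftrightarrow> barycentric T (contract (i, j) (length T + 3) s) v \<and>
    (s (i, length T + 3) + s (j, length T + 3)) * v (length T + 3)
      = s (i, length T + 3) * v j + s (j, length T + 3) * v i"
  using triangle_brackets_contract[OF assms, of _ _ _ s] bracket_last[OF assms(1,3-5), of _ s]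
  by (auto simp: barycentric_def)

lemma grad_form_at_last:
  assumes "is_two_tree T" "i < j" "j < length T + 3"
  defines "m \<equiv> length T + 3"
  shows "grad_form ((i, j) # T) s v m = s (i, m) / (v m - v i) + s (j, m) / (v m - v j)"
  unfolding grad_form_def sum_edges_attach[OF assms(1,2)] using assms
  by (simp add: incidence_beyond incidence_def[of _ "(_, _)"])

lemma apex_gaps:
  fixes a b p q r :: complex
  assumes "a + b \<noteq> 0" "(a + b) * r = a * q + b * p"
  shows "r - p = a * (q - p) / (a + b)" "r - q = - b * (q - p) / (a + b)"
proof -
  have "r = (a * q + b * p) / (a + b)" using assms by (simp add: field_simps)
  then show "r - p = a * (q - p) / (a + b)" "r - q = - b * (q - p) / (a + b)"
    using assms(1) by (simp_all add: field_simps)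
qed

text \<open>A vertex \<open>m\<close> placed at the weighted mean of the two vertices \<open>i\<close> and \<open>j\<close> it is attached to, with
  weights \<open>a\<close> and \<open>b\<close> and with \<open>d\<close> the gap between \<open>i\<close> and \<open>j\<close>.  In this situation the vertex can be
  eliminated.\<close>

locale attachment =
  fixes T :: two_tree and s :: "nat \<times> nat \<Rightarrow> complex" and i j m :: nat and v :: "nat \<Rightarrow> complex"
    and a b d :: complex
  assumes T: "is_two_tree T"
    and ij: "(i, j) \<in> insert (1, 2) (set (edges T))" "1 \<le> i" "i < j" "j < m"
    and m: "m = length T + 3"
    and ab: "a = s (i, m)" "b = s (j, m)" "a \<noteq> 0" "b \<noteq> 0" "a + b \<noteq> 0"
    and d: "d = v j - v i" "d \<noteq> 0"
    and apex: "(a + b) * v m = a * v j + b * v i"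
begin

lemma gaps: "v m - v i = a * d / (a + b)" "v m - v j = - b * d / (a + b)"
  using apex_gaps[OF ab(5) apex] by (simp_all add: d)

lemma grad_form_apex: "grad_form ((i, j) # T) s v m = 0"
proof -
  have "grad_form ((i, j) # T) s v m = a / (v m - v i) + b / (v m - v j)"
    using grad_form_at_last[OF T ij(3), of s v] ij m ab by simp
  also have "\<dots> = 0" unfolding gaps using ab d by (simp add: field_simps)
  finally show ?thesis .
qed

text \<open>The gaps to \<open>m\<close> are \<open>a d / (a + b)\<close> and \<open>- b d / (a + b)\<close>, so the edges \<open>im\<close> and \<open>jm\<close> act on \<open>i\<close>
  and \<open>j\<close> like an additional weight \<open>a + b\<close> on the edge \<open>ij\<close>.\<close>

lemma grad_form_contract:
  assumes "3 \<le> k" "k < m"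
  shows "grad_form ((i, j) # T) s v k = grad_form T (contract (i, j) m s) v k"
proof -
  define p q :: complex where "p = (if i = k then 1 else 0)" and "q = (if j = k then 1 else 0)"
  have "grad_form ((i, j) # T) s v k =
      grad_form T s v k + (a * (- p / (v m - v i)) + b * (- q / (v m - v j)))"
    unfolding grad_form_def sum_edges_attach[OF T ij(3)] using assms m
    by (simp add: ab incidence_def[of _ "(_, _)"] p_def q_def)
  also have "a * (- p / (v m - v i)) + b * (- q / (v m - v j)) = (a + b) * ((q - p) / d)"
    unfolding gaps using ab d(2) by (simp add: field_simps)
  also have "grad_form T s v k + \<dots> = grad_form T (contract (i, j) m s) v k"
    unfolding grad_form_def m
    by (subst sum_edges_contract[OF T ij(1)])
      (use assms in \<open>auto simp: incidence_def p_def q_def d m ab\<close>)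
  finally show ?thesis .
qed

lemma hess_form_apex:
  "hess_form ((i, j) # T) s v m m = - ((a + b) ^ 3) / (a * b * d\<^sup>2)"
proof -
  have "hess_form ((i, j) # T) s v m m = - a / (v m - v i)\<^sup>2 - b / (v m - v j)\<^sup>2"
    unfolding hess_form_def sum_edges_attach[OF T ij(3)] using ij m
    by (simp add: incidence_beyond[OF T] ab incidence_def[of _ "(_, _)"])
  also have "\<dots> = - ((a + b) ^ 3) / (a * b * d\<^sup>2)"
    unfolding gaps using ab d(2)
    by (simp add: field_simps power2_eq_square power3_eq_cube)
  finally show ?thesis .
qed

text \<open>The edges \<open>im\<close> and \<open>jm\<close> behave like two springs of stiffness \<open>A\<close> and \<open>B\<close> in series: eliminating
  \<open>m\<close> leaves a spring of stiffness \<open>A B / (A + B)\<close> between \<open>i\<close> and \<open>j\<close>.  At the weighted mean this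
  number is \<open>(a + b) / d\<^sup>2\<close>, the contribution of an additional weight \<open>a + b\<close> on \<open>ij\<close>.\<close>

lemma hess_form_contract:
  assumes "3 \<le> k" "k < m" "3 \<le> l" "l < m"
  shows "hess_form ((i, j) # T) s v k l
      - hess_form ((i, j) # T) s v k m * hess_form ((i, j) # T) s v m l / hess_form ((i, j) # T) s v m m
    = hess_form T (contract (i, j) m s) v k l"
proof -
  \<comment> \<open>The incidence of \<open>k\<close> with \<open>im\<close> is \<open>- p\<close>, as \<open>i\<close> is the smaller end; the others are similar.\<close>
  define p q p' q' :: complex where "p = (if i = k then 1 else 0)" and "q = (if j = k then 1 else 0)"
    and "p' = (if i = l then 1 else 0)" and "q' = (if j = l then 1 else 0)"
  define A B where "A = (a + b)\<^sup>2 / (a * d\<^sup>2)" and "B = (a + b)\<^sup>2 / (b * d\<^sup>2)"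
  have AB: "a / (v m - v i)\<^sup>2 = A" "b / (v m - v j)\<^sup>2 = B" "A * B / (A + B) = (a + b) / d\<^sup>2" "A + B \<noteq> 0"
  proof -
    show "a / (v m - v i)\<^sup>2 = A" "b / (v m - v j)\<^sup>2 = B"
      unfolding gaps A_def B_def using ab d(2) by (simp_all add: field_simps power2_eq_square)
    have sum: "A + B = (a + b) ^ 3 / (a * b * d\<^sup>2)"
      unfolding A_def B_def using ab d(2) by (simp add: field_simps power2_eq_square power3_eq_cube)
    then show "A + B \<noteq> 0" using ab d(2) by simp
    show "A * B / (A + B) = (a + b) / d\<^sup>2"
      unfolding sum unfolding A_def B_def using ab(3-5) d(2)
      by (simp add: divide_simps power2_eq_square power3_eq_cube)
  qed
  have kl: "hess_form ((i, j) # T) s v k l = hess_form T s v k l - A * p * p' - B * q * q'"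
    unfolding hess_form_def sum_edges_attach[OF T ij(3)] AB(1,2)[symmetric] using assms m
    by (simp add: ab incidence_def[of _ "(_, _)"] p_def q_def p'_def q'_def)
  have km: "hess_form ((i, j) # T) s v k m = A * p + B * q"
    unfolding hess_form_def sum_edges_attach[OF T ij(3)] AB(1,2)[symmetric] using assms m ij
    by (simp add: incidence_beyond[OF T] ab incidence_def[of _ "(_, _)"] p_def q_def)
  have ml: "hess_form ((i, j) # T) s v m l = A * p' + B * q'"
    unfolding hess_form_def sum_edges_attach[OF T ij(3)] AB(1,2)[symmetric] using assms m ij
    by (simp add: incidence_beyond[OF T] ab incidence_def[of _ "(_, _)"] p'_def q'_def)
  have mm: "hess_form ((i, j) # T) s v m m = - (A + B)"
    unfolding hess_form_def sum_edges_attach[OF T ij(3)] AB(1,2)[symmetric] using assms m ij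
    by (simp add: incidence_beyond[OF T] ab incidence_def[of _ "(_, _)"])
  have "hess_form ((i, j) # T) s v k l
      - hess_form ((i, j) # T) s v k m * hess_form ((i, j) # T) s v m l / hess_form ((i, j) # T) s v m m
    = hess_form T s v k l - A * B / (A + B) * ((q - p) * (q' - p'))"
  proof -
    define C where "C = A + B"
    have "(A * p + B * q) * (A * p' + B * q') =
        C * (A * p * p' + B * q * q') - A * B * ((q - p) * (q' - p'))"
      by (simp add: C_def algebra_simps)
    then have "(A * p + B * q) * (A * p' + B * q') / C =
        A * p * p' + B * q * q' - A * B / C * ((q - p) * (q' - p'))"
      using AB(4) by (simp add: diff_divide_distrib C_def)
    then show ?thesis unfolding kl km ml mm C_def[symmetric] by simp
  qed
  also have "\<dots> = hess_form T s v k l + (a + b) * (- (q - p) * (q' - p') / d\<^sup>2)"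
    unfolding AB using d(2) by (simp add: field_simps)
  also have "\<dots> = hess_form T (contract (i, j) m s) v k l"
    unfolding hess_form_def m
    by (subst sum_edges_contract[OF T ij(1)])
      (use assms in \<open>auto simp: incidence_def p_def q_def p'_def q'_def d m ab\<close>)
  finally show ?thesis .
qed

end

lemma gap_edge_or_root:
  assumes "v 1 \<noteq> v 2" "\<forall>e\<in>set (edges T). gap v e \<noteq> 0" "(i, j) \<in> insert (1, 2) (set (edges T))"
  shows "v j - v i \<noteq> 0"
  using assms by force

text \<open>The equation for the last vertex forces it to be the weighted mean of \<open>i\<close> and \<open>j\<close>, and by
  \<open>grad_form_contract\<close> the remaining equations are those of the contracted 2-tree.\<close>

lemma stationary_iff_barycentric:
  assumes "is_two_tree T" "generic T s" "v 1 \<noteq> v 2"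
  shows "stationary T s v \<longleftrightarrow> barycentric T s v"
  using assms
proof (induction arbitrary: s rule: two_tree_induct)
  case edge
  then show ?case by (auto simp: stationary_def barycentric_def)
next
  case (attach i j T)
  define m where "m = length T + 3"
  define a b d where "a = s (i, m)" and "b = s (j, m)" and "d = v j - v i"
  let ?s = "contract (i, j) m s"
  note gen = attach.prems(1)[unfolded generic_attach[OF attach.hyps], folded m_def, folded a_def b_def]
  have attachment: "attachment T s i j m v a b d" if "d \<noteq> 0" "(a + b) * v m = a * v j + b * v i"
    using attach.hyps gen that by unfold_locales (auto simp: m_def a_def b_def d_def)
  have IH: "stationary T ?s v \<longleftrightarrow> barycentric T ?s v"
    using attach.IH[of ?s] attach.prems(2) gen by blast
  have "stationary ((i, j) # T) s v \<longleftrightarrow> stationary T ?s v \<and> (a + b) * v m = a * v j + b * v i"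
  proof (intro iffI conjI)
    assume st: "stationary ((i, j) # T) s v"
    then have nz: "v m - v i \<noteq> 0" "v m - v j \<noteq> 0" "\<forall>e\<in>set (edges T). gap v e \<noteq> 0"
      by (auto simp: stationary_def m_def)
    then have d: "d \<noteq> 0" using gap_edge_or_root[OF attach.prems(2) _ attach.hyps(2)] by (simp add: d_def)
    have "grad_form ((i, j) # T) s v m = a / (v m - v i) + b / (v m - v j)"
      using grad_form_at_last[OF attach.hyps(1,4,5), of s v] by (simp add: m_def a_def b_def)
    moreover have "grad_form ((i, j) # T) s v m = 0" using st by (simp add: stationary_def m_def)
    \<comment> \<open>The common denominator of the two terms is nonzero.\<close>
    ultimately have "a * (v m - v j) + b * (v m - v i) = 0" using nz by (simp add: add_frac_eq)
    then show apex: "(a + b) * v m = a * v j + b * v i" by (simp add: algebra_simps)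
    interpret attachment T s i j m v a b d by (rule attachment[OF d apex])
    show "stationary T ?s v"
      using st nz(3) grad_form_contract by (auto simp: stationary_def m_def)
  next
    assume st: "stationary T ?s v \<and> (a + b) * v m = a * v j + b * v i"
    then have d: "d \<noteq> 0"
      using gap_edge_or_root[OF attach.prems(2) _ attach.hyps(2)] by (simp add: stationary_def d_def)
    interpret attachment T s i j m v a b d by (rule attachment) (use d st in auto)
    have "v m - v i \<noteq> 0" "v m - v j \<noteq> 0" unfolding gaps using ab d by auto
    then have "\<forall>e\<in>set (edges ((i, j) # T)). gap v e \<noteq> 0" using st by (simp add: stationary_def m_def)
    moreover have "grad_form ((i, j) # T) s v k = 0" if "3 \<le> k" "k < length ((i, j) # T) + 3" for k
    proof (cases "k = m")
      case True
      then show ?thesis using grad_form_apex by simp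
    next
      case False
      then have "k < m" using that by (simp add: m_def)
      then show ?thesis using st that grad_form_contract[of k] by (simp add: stationary_def m_def)
    qed
    ultimately show "stationary ((i, j) # T) s v" by (simp add: stationary_def)
  qed
  then show ?case
    using IH barycentric_attach[OF attach.hyps] by (simp add: m_def a_def b_def)
qed

lemma barycentric_exists:
  assumes "is_two_tree T" "generic T s"
  shows "\<exists>v. v 1 = 0 \<and> v 2 = 1 \<and> barycentric T s v"
  using assms
proof (induction arbitrary: s rule: two_tree_induct)
  case edge
  show ?case by (rule exI[of _ "\<lambda>k. if k = 1 then 0 else 1"]) (simp add: barycentric_def)
next
  case (attach i j T)
  let ?m = "length T + 3"
  let ?s = "contract (i, j) ?m s"
  note gen = attach.prems[unfolded generic_attach[OF attach.hyps]]
  obtain v where v: "v 1 = 0" "v 2 = 1" "barycentric T ?s v" using attach.IH[of ?s] gen by blast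
  define w where "w = v(?m := (s (i, ?m) * v j + s (j, ?m) * v i) / (s (i, ?m) + s (j, ?m)))"
  have w: "w k = v k" if "k < ?m" for k using that by (simp add: w_def)
  have "barycentric T ?s w"
    unfolding barycentric_def
  proof safe
    fix p q k assume t: "(p, q, k) \<in> set (triangles T)"
    then have "w p = v p" "w q = v q" "w k = v k"
      using triangle_bounds[OF attach.hyps(1) t] by (auto intro: w)
    then show "(bracket T ?s (p, k) + bracket T ?s (q, k)) * w k =
        bracket T ?s (p, k) * w q + bracket T ?s (q, k) * w p"
      using v(3) t by (auto simp: barycentric_def)
  qed
  moreover have "w i = v i" "w j = v j" using attach.hyps by (auto intro: w)
  ultimately have "barycentric ((i, j) # T) s w"
    unfolding barycentric_attach[OF attach.hyps] using gen by (simp add: w_def)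
  moreover have "w 1 = 0" "w 2 = 1" using v w by auto
  ultimately show ?case by blast
qed

lemma barycentric_unique:
  assumes "is_two_tree T" "generic T s" "v 1 = w 1" "v 2 = w 2" "barycentric T s v" "barycentric T s w"
    and "1 \<le> k" "k < length T + 3"
  shows "v k = w k"
  using assms
proof (induction arbitrary: s k rule: two_tree_induct)
  case edge
  then have "k = 1 \<or> k = 2" by auto
  then show ?case using edge by auto
next
  case (attach i j T)
  let ?m = "length T + 3"
  note gen = attach.prems(1)[unfolded generic_attach[OF attach.hyps]]
  note bary = attach.prems(4,5)[unfolded barycentric_attach[OF attach.hyps]]
  have IH: "v k = w k" if "1 \<le> k" "k < ?m" for k
    using attach.IH[of "contract (i, j) ?m s" k] attach.prems(2,3) gen bary that by blast
  show ?case
  proof (cases "k = ?m")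
    case True
    have "v i = w i" "v j = w j" using IH attach.hyps by auto
    then show ?thesis using bary gen True by (metis mult_cancel_left)
  qed (use IH attach.prems in auto)
qed

section \<open>The Hessian determinant\<close>

text \<open>Subtracting multiples of the last column clears the last row left of the diagonal.\<close>

lemma det_schur_complement:
  fixes f :: "nat \<Rightarrow> nat \<Rightarrow> complex"
  assumes "f m m \<noteq> 0"
  shows "Determinant.det (mat (Suc m) (Suc m) (\<lambda>(r, c). f r c)) =
    f m m * Determinant.det (mat m m (\<lambda>(r, c). f r c - f r m * f m c / f m m))"
proof -
  let ?A = "mat (Suc m) (Suc m) (\<lambda>(r, c). f r c)"
  let ?U = "four_block_mat (1\<^sub>m m) (0\<^sub>m m 1) (mat 1 m (\<lambda>(r, c). - f m c / f m m)) (1\<^sub>m 1)"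
  let ?S = "mat m m (\<lambda>(r, c). f r c - f r m * f m c / f m m)"
  let ?B = "four_block_mat ?S (mat m 1 (\<lambda>(r, c). f r m)) (0\<^sub>m 1 m) (mat 1 1 (\<lambda>_. f m m))"
  have A: "?A = four_block_mat (mat m m (\<lambda>(r, c). f r c)) (mat m 1 (\<lambda>(r, c). f r m))
      (mat 1 m (\<lambda>(r, c). f m c)) (mat 1 1 (\<lambda>_. f m m))"
    by (rule eq_matI) (auto simp: less_Suc_eq)
  have prod: "?A * ?U = ?B"
    unfolding A
    by (subst mult_four_block_mat[where ?nr1.0 = m and ?n1.0 = m and ?n2.0 = 1 and ?nr2.0 = 1
            and ?nc1.0 = m and ?nc2.0 = 1])
      (auto intro!: cong_four_block_mat eq_matI simp: assms scalar_prod_def algebra_simps)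
  have det_U: "Determinant.det ?U = 1"
    using det_four_block_mat_upper_right_zero[of "1\<^sub>m m" m "0\<^sub>m m 1" 1
        "mat 1 m (\<lambda>(r, c). - f m c / f m m)" "1\<^sub>m 1"] by simp
  have det_B: "Determinant.det ?B = Determinant.det ?S * f m m"
    by (subst det_four_block_mat_lower_left_zero[where n = m and m = 1]) (auto simp: det_single)
  have "Determinant.det (?A * ?U) = Determinant.det ?A * Determinant.det ?U"
    by (rule det_mult[of _ "Suc m"]) auto
  from this[unfolded prod det_B det_U mult_1_right] show ?thesis
    by (rule trans[OF sym mult.commute])
qed

lemma det_hess_form:
  assumes "is_two_tree T" "generic T s" "v 1 \<noteq> v 2" "stationary T s v"
  shows "Determinant.det (mat (length T) (length T) (\<lambda>(r, c). hess_form T s v (r + 3) (c + 3))) =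
    (\<Prod>(i, j, k)\<leftarrow>triangles T. - ((bracket T s (i, k) + bracket T s (j, k)) ^ 3) /
      (bracket T s (i, k) * bracket T s (j, k) * (v j - v i)\<^sup>2))"
  using assms
proof (induction arbitrary: s rule: two_tree_induct)
  case edge
  then show ?case by simp
next
  case (attach i j T)
  define m where "m = length T + 3"
  define a b d where "a = s (i, m)" and "b = s (j, m)" and "d = v j - v i"
  let ?s = "contract (i, j) m s" and ?T = "(i, j) # T"
  note gen = attach.prems(1)[unfolded generic_attach[OF attach.hyps], folded m_def, folded a_def b_def]
  have "barycentric ?T s v"
    using attach.prems attach.hyps stationary_iff_barycentric[of ?T s v] by simp
  note bary = this[unfolded barycentric_attach[OF attach.hyps], folded m_def, folded a_def b_def]
  then have st: "stationary T ?s v"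
    using stationary_iff_barycentric[OF attach.hyps(1)] gen attach.prems(2) by blast
  then have "d \<noteq> 0"
    using gap_edge_or_root[OF attach.prems(2) _ attach.hyps(2)] by (simp add: stationary_def d_def)
  then interpret attachment T s i j m v a b d
    using attach.hyps gen bary by unfold_locales (auto simp: m_def a_def b_def d_def)
  let ?f = "\<lambda>r c. hess_form ?T s v (r + 3) (c + 3)"
  have apex: "?f (length T) (length T) = - ((a + b) ^ 3) / (a * b * d\<^sup>2)"
    using hess_form_apex by (simp add: m_def)
  then have nz: "?f (length T) (length T) \<noteq> 0" using ab d by simp
  have "Determinant.det (mat (length ?T) (length ?T) (\<lambda>(r, c). ?f r c)) =
      - ((a + b) ^ 3) / (a * b * d\<^sup>2) * Determinant.det (mat (length T) (length T)
        (\<lambda>(r, c). ?f r c - ?f r (length T) * ?f (length T) c / ?f (length T) (length T)))"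
    unfolding list.size(4) add_0_right add_Suc_right
    using det_schur_complement[of ?f "length T", OF nz] unfolding apex by simp
  also have "mat (length T) (length T)
        (\<lambda>(r, c). ?f r c - ?f r (length T) * ?f (length T) c / ?f (length T) (length T)) =
      mat (length T) (length T) (\<lambda>(r, c). hess_form T ?s v (r + 3) (c + 3))"
  proof (rule cong_mat)
    fix r c assume "r < length T" "c < length T"
    then show "(case (r, c) of (r, c) \<Rightarrow>
          ?f r c - ?f r (length T) * ?f (length T) c / ?f (length T) (length T)) =
        (case (r, c) of (r, c) \<Rightarrow> hess_form T ?s v (r + 3) (c + 3))"
      using hess_form_contract[of "r + 3" "c + 3"] by (simp add: m_def)
  qed simp_all
  also have "Determinant.det \<dots> = (\<Prod>(i, j, k)\<leftarrow>triangles T. - ((bracket T ?s (i, k) + bracket T ?s (j, k)) ^ 3) /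
      (bracket T ?s (i, k) * bracket T ?s (j, k) * (v j - v i)\<^sup>2))"
    by (rule attach.IH) (use gen attach.prems st in auto)
  also have "\<dots> = (\<Prod>(i, j, k)\<leftarrow>triangles T. - ((bracket ?T s (i, k) + bracket ?T s (j, k)) ^ 3) /
      (bracket ?T s (i, k) * bracket ?T s (j, k) * (v j - v i)\<^sup>2))"
    by (rule arg_cong[of _ _ prod_list], rule map_cong[OF refl])
      (use triangle_brackets_contract[OF attach.hyps, of _ _ _ s] in \<open>auto simp: m_def\<close>)
  finally show ?case
    using bracket_last[OF attach.hyps(1,3-5), of _ s] by (simp add: m_def a_def b_def d_def)
qed

section \<open>Derivatives of the potential\<close>

lemma position_root: "position x 1 = 0" "position x (Suc 0) = 0" "position x 2 = 1"
  by (simp_all add: position_def)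

lemma position_upd:
  assumes "1 \<le> a"
  shows "position (x(a := z)) k = (if k = a + 2 then z else position x k)"
  using assms by (auto simp: position_def)

lemma pl_edge:
  assumes "is_two_tree T" "n = length T + 3" "(i, j) \<in> set (edges T)"
  shows "pl n i j x = gap (position x) (i, j)"
  using edges_bounds[OF assms(1,3)] assms(2) by (simp add: pl_finite)

lemma L_pot_conv:
  assumes "is_two_tree T" "n = length T + 3"
  shows "L_pot n T s x0 x = (\<Sum>e\<in>set (edges T). s e * (Ln (gap (position x0) e)
    + Ln (gap (position x) e / gap (position x0) e)))"
  unfolding L_pot_def by (rule sum.cong) (use pl_edge[OF assms] in auto)

lemma gap_has_derivative:
  assumes "1 \<le> a"
  shows "((\<lambda>z. gap (position (x(a := z))) e) has_field_derivative incidence (a + 2) e) (at z)"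
proof -
  have "((\<lambda>z. position (x(a := z)) k) has_field_derivative (if k = a + 2 then 1 else 0)) (at z)" for k
    by (simp add: position_upd[OF assms])
  then show ?thesis unfolding gap_def incidence_def by (intro DERIV_diff)
qed

text \<open>The branch based at \<open>x0\<close> is differentiable wherever none of the quotients meets the cut.\<close>

definition off_cut :: "two_tree \<Rightarrow> (nat \<Rightarrow> complex) \<Rightarrow> (nat \<Rightarrow> complex) \<Rightarrow> bool" where
  "off_cut T x0 y \<longleftrightarrow> (\<forall>e\<in>set (edges T). gap (position y) e / gap (position x0) e \<notin> \<real>\<^sub>\<le>\<^sub>0)"

lemma partial_L_pot:
  assumes "is_two_tree T" "n = length T + 3" "1 \<le> a" "off_cut T x0 y"
  shows "partial a (L_pot n T s x0) y = grad_form T s (position y) (a + 2)"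
proof -
  have summand: "((\<lambda>z. s e * (Ln (gap (position x0) e) + Ln (gap (position (y(a := z))) e / gap (position x0) e)))
      has_field_derivative s e * (incidence (a + 2) e / gap (position y) e)) (at (y a))"
    if e: "e \<in> set (edges T)" for e
  proof -
    have q: "gap (position y) e / gap (position x0) e \<notin> \<real>\<^sub>\<le>\<^sub>0"
      using assms(4) e by (simp add: off_cut_def)
    then have nz: "gap (position x0) e \<noteq> 0" "gap (position y) e \<noteq> 0" by auto
    have "((\<lambda>z. gap (position (y(a := z))) e / gap (position x0) e) has_field_derivative incidence (a + 2) e / gap (position x0) e) (at (y a))"
      by (intro DERIV_cdivide gap_has_derivative assms(3))
    moreover have "(Ln has_field_derivative inverse (gap (position y) e / gap (position x0) e)) (at (gap (position (y(a := y a))) e / gap (position x0) e))"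
      using has_field_derivative_Ln[OF q] by simp
    ultimately have "((\<lambda>z. Ln (gap (position (y(a := z))) e / gap (position x0) e)) has_field_derivative
        inverse (gap (position y) e / gap (position x0) e) * (incidence (a + 2) e / gap (position x0) e)) (at (y a))"
      by (rule DERIV_chain2[rotated])
    from DERIV_cmult[OF DERIV_add[OF DERIV_const this], of "s e"] show ?thesis using nz by simp
  qed
  then have "((\<lambda>z. L_pot n T s x0 (y(a := z))) has_field_derivative grad_form T s (position y) (a + 2)) (at (y a))"
    unfolding L_pot_conv[OF assms(1,2)] grad_form_def by (rule DERIV_sum)
  then show ?thesis unfolding partial_def by (rule DERIV_imp_deriv)
qed

lemma off_cut_self:
  "\<forall>e\<in>set (edges T). gap (position x) e \<noteq> 0 \<Longrightarrow> off_cut T x x"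
  by (simp add: off_cut_def)

text \<open>Second derivatives at \<open>x\<close> need the first derivatives near \<open>x\<close>.  The quotients equal 1 at \<open>x\<close>, so
  by continuity they stay off the cut in a neighbourhood.\<close>

lemma eventually_off_cut:
  assumes "\<forall>e\<in>set (edges T). gap (position x) e \<noteq> 0" "1 \<le> a"
  shows "eventually (\<lambda>z. off_cut T x (x(a := z))) (nhds (x a))"
  unfolding off_cut_def
proof (rule eventually_ball_finite)
  show "\<forall>e\<in>set (edges T). eventually
      (\<lambda>z. gap (position (x(a := z))) e / gap (position x) e \<notin> \<real>\<^sub>\<le>\<^sub>0) (nhds (x a))"
  proof
    fix e assume e: "e \<in> set (edges T)"
    let ?q = "\<lambda>z. gap (position (x(a := z))) e / gap (position x) e"
    have "isCont ?q (x a)"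
      using DERIV_isCont[OF gap_has_derivative[OF assms(2), of x e "x a"]] assms(1) e by simp
    then have "(?q \<longlongrightarrow> 1) (at (x a))" using assms(1) e by (simp add: isCont_def)
    then have "eventually (\<lambda>z. ?q z \<in> - \<real>\<^sub>\<le>\<^sub>0) (at (x a))"
      by (rule topological_tendstoD) auto
    then show "eventually (\<lambda>z. ?q z \<notin> \<real>\<^sub>\<le>\<^sub>0) (nhds (x a))"
      using assms(1) e by (simp add: eventually_nhds_conv_at)
  qed
qed simp

lemma partial_partial_L_pot:
  assumes "is_two_tree T" "n = length T + 3" "1 \<le> a" "1 \<le> b"
    and nz: "\<forall>e\<in>set (edges T). gap (position x) e \<noteq> 0"
  shows "partial a (partial b (L_pot n T s x)) x = hess_form T s (position x) (a + 2) (b + 2)"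
proof -
  have "partial a (partial b (L_pot n T s x)) x =
      deriv (\<lambda>z. grad_form T s (position (x(a := z))) (b + 2)) (x a)"
    unfolding partial_def[of a]
    by (intro deriv_cong_ev refl eventually_mono[OF eventually_off_cut[OF nz assms(3)]]
        partial_L_pot assms)
  also have "\<dots> = hess_form T s (position x) (a + 2) (b + 2)"
  proof (rule DERIV_imp_deriv)
    have "((\<lambda>z. s e * (incidence (b + 2) e / gap (position (x(a := z))) e)) has_field_derivative
        s e * (- incidence (a + 2) e * incidence (b + 2) e / (gap (position x) e)\<^sup>2)) (at (x a))"
      if e: "e \<in> set (edges T)" for e
    proof -
      have "((\<lambda>z. incidence (b + 2) e / gap (position (x(a := z))) e) has_field_derivative
          (0 * gap (position (x(a := x a))) e - incidence (b + 2) e * incidence (a + 2) e) /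
          (gap (position (x(a := x a))) e * gap (position (x(a := x a))) e)) (at (x a))"
        by (rule DERIV_divide[OF DERIV_const gap_has_derivative[OF assms(3)]]) (use nz e in simp)
      from DERIV_cmult[OF this, of "s e"] show ?thesis by (simp add: power2_eq_square mult_ac)
    qed
    then show "((\<lambda>z. grad_form T s (position (x(a := z))) (b + 2)) has_field_derivative
        hess_form T s (position x) (a + 2) (b + 2)) (at (x a))"
      unfolding grad_form_def hess_form_def by (rule DERIV_sum)
  qed
  finally show ?thesis .
qed

lemma critical_point_iff:
  assumes "is_two_tree T" "n = length T + 3"
  shows "critical_point n T s x \<longleftrightarrow> x \<in> extensional {1..length T} \<and> stationary T s (position x)"
proof -
  have "(\<forall>(i, j)\<in>set (edges T). pl n i j x \<noteq> 0) \<longleftrightarrow> (\<forall>e\<in>set (edges T). gap (position x) e \<noteq> 0)"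
    using pl_edge[OF assms] by auto
  moreover have "(\<forall>a\<in>{1..n - 3}. partial a (L_pot n T s x) x = 0) \<longleftrightarrow>
      (\<forall>k. 3 \<le> k \<and> k < length T + 3 \<longrightarrow> grad_form T s (position x) k = 0)"
    if "\<forall>e\<in>set (edges T). gap (position x) e \<noteq> 0"
  proof -
    have "(\<forall>a\<in>{1..n - 3}. partial a (L_pot n T s x) x = 0) \<longleftrightarrow>
        (\<forall>a\<in>{1..length T}. grad_form T s (position x) (a + 2) = 0)"
      using partial_L_pot[OF assms _ off_cut_self[OF that]] assms(2) by simp
    also have "\<dots> \<longleftrightarrow> (\<forall>k\<in>(\<lambda>a. a + 2) ` {1..length T}. grad_form T s (position x) k = 0)" by simp
    also have "(\<lambda>a. a + 2) ` {1..length T} = {3..length T + 2}"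
      using image_add_atLeastAtMost'[of 2 1 "length T"] by simp
    finally show ?thesis by (auto simp: less_Suc_eq_le)
  qed
  ultimately show ?thesis
    using assms(2) by (auto simp: critical_point_def stationary_def)
qed

text \<open>The weighted means determine the coordinates of the vertices one after the other.  Passing between
  points and coordinates shifts indices by 2, since 1 and 2 are fixed vertices.\<close>

lemma critical_point_unique:
  assumes "is_two_tree T" "n = length T + 3" "generic T s"
  shows "\<exists>!x. critical_point n T s x"
proof -
  have iff: "critical_point n T s x \<longleftrightarrow> x \<in> extensional {1..length T} \<and> barycentric T s (position x)" for x
    using critical_point_iff[OF assms(1,2)] stationary_iff_barycentric[OF assms(1,3), of "position x"]
    by (simp add: position_root)
  obtain v where v: "v 1 = 0" "v 2 = 1" "barycentric T s v" using barycentric_exists[OF assms(1,3)] by blast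
  define x where "x = restrict (\<lambda>a. v (a + 2)) {1..length T}"
  have pos: "position x k = v k" if "1 \<le> k" "k < length T + 3" for k
  proof (cases "k \<le> 2")
    case True
    then have "k = 1 \<or> k = 2" using that by auto
    then show ?thesis using v position_root by auto
  next
    case False
    then have "k - 2 \<in> {1..length T}" "k - 2 + 2 = k" using that by auto
    then show ?thesis using False by (auto simp: position_def x_def)
  qed
  have "barycentric T s (position x)"
    unfolding barycentric_def
  proof safe
    fix i j k assume t: "(i, j, k) \<in> set (triangles T)"
    then have "position x i = v i" "position x j = v j" "position x k = v k"
      using triangle_bounds[OF assms(1) t] by (auto intro: pos)
    then show "(bracket T s (i, k) + bracket T s (j, k)) * position x k =
        bracket T s (i, k) * position x j + bracket T s (j, k) * position x i"
      using v(3) t by (auto simp: barycentric_def)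
  qed
  then have "critical_point n T s x" unfolding iff by (simp add: x_def)
  moreover have "y = x" if y: "critical_point n T s y" for y
  proof
    fix a
    have ext: "x \<in> extensional {1..length T}" "y \<in> extensional {1..length T}"
      "barycentric T s (position x)" "barycentric T s (position y)"
      using y \<open>critical_point n T s x\<close> unfolding iff by auto
    show "y a = x a"
    proof (cases "a \<in> {1..length T}")
      case True
      then have "position y (a + 2) = position x (a + 2)"
        using barycentric_unique[OF assms(1,3) _ _ ext(4,3), of "a + 2"] by (simp add: position_root)
      then show ?thesis using True by (simp add: position_def)
    next
      case False
      then show ?thesis using ext by (simp add: extensional_def)
    qed
  qed
  ultimately show ?thesis by blast
qed

lemma hess_eq:
  assumes "is_two_tree T" "n = length T + 3" "generic T s" "critical_point n T s x"
  shows "hess n T s x = (\<Prod>(i, j, k)\<leftarrow>triangles T. - ((bracket T s (i, k) + bracket T s (j, k)) ^ 3) /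
      (bracket T s (i, k) * bracket T s (j, k) * (position x j - position x i)\<^sup>2))"
proof -
  have st: "stationary T s (position x)" using assms critical_point_iff by blast
  have "mat (n - 3) (n - 3) (\<lambda>(a, b). partial (a + 1) (partial (b + 1) (L_pot n T s x)) x) =
      mat (length T) (length T) (\<lambda>(r, c). hess_form T s (position x) (r + 3) (c + 3))"
    using assms(2) partial_partial_L_pot[OF assms(1,2), of "_ + 1" "_ + 1" x s] st
    by (intro cong_mat) (auto simp: stationary_def numeral_3_eq_3)
  then show ?thesis
    unfolding hess_def using det_hess_form[OF assms(1,3) _ st] by (simp add: position_root)
qed

section \<open>The amplitude\<close>

lemma critical_gaps:
  assumes "is_two_tree T" "n = length T + 3" "generic T s" "critical_point n T s x"
    and t: "(i, j, k) \<in> set (triangles T)"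
  shows "position x j - position x i \<noteq> 0"
    "position x k - position x i = bracket T s (i, k) * (position x j - position x i) /
      (bracket T s (i, k) + bracket T s (j, k))"
    "position x k - position x j = - bracket T s (j, k) * (position x j - position x i) /
      (bracket T s (i, k) + bracket T s (j, k))"
proof -
  have st: "stationary T s (position x)" using critical_point_iff[OF assms(1,2)] assms(4) by simp
  show "position x j - position x i \<noteq> 0"
    using gap_edge_or_root[of "position x" T i j] st triangle_edges[OF assms(1) t]
    by (simp add: stationary_def position_root)
  have "barycentric T s (position x)"
    using st stationary_iff_barycentric[OF assms(1,3)] by (simp add: position_root)
  then show "position x k - position x i = bracket T s (i, k) * (position x j - position x i) /
      (bracket T s (i, k) + bracket T s (j, k))"
    "position x k - position x j = - bracket T s (j, k) * (position x j - position x i) /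
      (bracket T s (i, k) + bracket T s (j, k))"
    using apex_gaps assms(3) t by (fastforce simp: barycentric_def generic_def)+
qed

lemma integrand_eq:
  assumes "is_two_tree T" "n = length T + 3"
  shows "integrand n T x = (\<Prod>(i, j, k)\<in>set (triangles T). (position x j - position x i)\<^sup>2) /
    (\<Prod>(i, j, k)\<in>set (triangles T). (position x j - position x i) *
      (position x k - position x i) * (position x k - position x j))"
proof -
  have tri: "pl n i j x = position x j - position x i" "pl n i k x = position x k - position x i"
    "pl n j k x = position x k - position x j" if "(i, j, k) \<in> set (triangles T)" for i j k
    using triangle_bounds[OF assms(1) that] assms(2) by (simp_all add: pl_finite)
  have "(apex_prod n T x)\<^sup>2 = (\<Prod>(i, j, k)\<in>set (triangles T). (position x j - position x i)\<^sup>2)"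
    unfolding apex_prod_def prod.distinct_set_conv_list[OF distinct_triangles[OF assms(1)], symmetric]
      prod_power_distrib
    by (rule prod.cong) (use tri in auto)
  moreover have "(\<Prod>(i, j, k)\<leftarrow>triples n T. pl n i j x * pl n i k x * pl n j k x) =
      (\<Prod>(i, j, k)\<leftarrow>triangles T. pl n i j x * pl n i k x * pl n j k x)"
    using assms(2) by (simp add: triples_def pl_finite pl_infinity position_root)
  moreover have "\<dots> = (\<Prod>(i, j, k)\<in>set (triangles T). (position x j - position x i) *
      (position x k - position x i) * (position x k - position x j))"
    unfolding prod.distinct_set_conv_list[OF distinct_triangles[OF assms(1)], symmetric]
    by (rule prod.cong) (use tri in auto)
  ultimately show ?thesis by (simp add: integrand_def Delta_square[OF assms])
qed

text \<open>One factor of the integrand at the critical point is \<open>- (a + b)\<^sup>2 / (a b d)\<close> with \<open>d = p\<^sub>i\<^sub>j\<close>.  Its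
  square divided by \<open>- (a + b)\<^sup>3 / (a b d\<^sup>2)\<close> is free of \<open>d\<close>.\<close>

lemma amplitude_eq:
  assumes "is_two_tree T" "n = length T + 3" "generic T s"
  shows "amplitude n T s = - (\<Prod>(i, j, k)\<in>set (triangles T).
    - (bracket T s (i, k) + bracket T s (j, k)) / (bracket T s (i, k) * bracket T s (j, k)))"
proof -
  define x where "x = (THE x. critical_point n T s x)"
  have x: "critical_point n T s x"
    unfolding x_def by (rule theI'[OF critical_point_unique[OF assms]])
  let ?v = "position x" and ?A = "\<lambda>i k. bracket T s (i, k)"
  have "- (integrand n T x)\<^sup>2 / hess n T s x = - (\<Prod>(i, j, k)\<in>set (triangles T).
      ((?v j - ?v i)\<^sup>2 / ((?v j - ?v i) * (?v k - ?v i) * (?v k - ?v j)))\<^sup>2 /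
      (- ((?A i k + ?A j k) ^ 3) / (?A i k * ?A j k * (?v j - ?v i)\<^sup>2)))"
    unfolding integrand_eq[OF assms(1,2)] hess_eq[OF assms x]
      prod.distinct_set_conv_list[OF distinct_triangles[OF assms(1)], symmetric]
    by (simp only: case_prod_unfold prod_dividef prod_power_distrib[symmetric] minus_divide_left)
  also have "\<dots> = - (\<Prod>(i, j, k)\<in>set (triangles T). - (?A i k + ?A j k) / (?A i k * ?A j k))"
  proof (rule arg_cong[of _ _ uminus], rule prod.cong[OF refl], safe)
    fix i j k assume t: "(i, j, k) \<in> set (triangles T)"
    define d a b where "d = ?v j - ?v i" and "a = ?A i k" and "b = ?A j k"
    note gaps = critical_gaps[OF assms x t, folded d_def, folded a_def b_def]
    have nz: "a \<noteq> 0" "b \<noteq> 0" "a + b \<noteq> 0" "d \<noteq> 0"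
      using assms(3) t gaps(1) by (auto simp: generic_def a_def b_def)
    have I: "d\<^sup>2 / (d * (?v k - ?v i) * (?v k - ?v j)) = - ((a + b)\<^sup>2 / (a * b * d))"
      unfolding gaps using nz by (simp add: field_simps power2_eq_square)
    have "(- ((a + b)\<^sup>2 / (a * b * d)))\<^sup>2 / (- ((a + b) ^ 3) / (a * b * d\<^sup>2)) = - (a + b) / (a * b)"
    proof -
      define c where "c = a + b"
      show ?thesis
        unfolding c_def[symmetric] using nz[folded c_def]
        by (simp add: field_simps power2_eq_square power3_eq_cube)
    qed
    then show "((?v j - ?v i)\<^sup>2 / ((?v j - ?v i) * (?v k - ?v i) * (?v k - ?v j)))\<^sup>2 /
        (- ((?A i k + ?A j k) ^ 3) / (?A i k * ?A j k * (?v j - ?v i)\<^sup>2)) =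
        - (?A i k + ?A j k) / (?A i k * ?A j k)"
      unfolding d_def[symmetric] a_def[symmetric] b_def[symmetric] I .
  qed
  finally show ?thesis by (simp add: amplitude_def x_def[symmetric] Let_def)
qed

text \<open>The \<open>n - 3\<close> signs of the factors and the sign in front combine to \<open>(-1)\<^sup>n\<close>.\<close>

lemma amplitude_signed:
  assumes "is_two_tree T" "n = length T + 3" "generic T s"
  shows "amplitude n T s = (-1) ^ n * (\<Prod>(i, j, k)\<in>set (triangles T).
    (bracket T s (i, k) + bracket T s (j, k)) / (bracket T s (i, k) * bracket T s (j, k)))"
proof -
  let ?f = "\<lambda>(i, j, k). (bracket T s (i, k) + bracket T s (j, k)) / (bracket T s (i, k) * bracket T s (j, k))"
  have "(\<Prod>(i, j, k)\<in>set (triangles T).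
      - (bracket T s (i, k) + bracket T s (j, k)) / (bracket T s (i, k) * bracket T s (j, k))) =
      (\<Prod>t\<in>set (triangles T). - ?f t)"
    by (rule prod.cong) (auto simp: minus_divide_left)
  also have "\<dots> = (- 1) ^ length T * (\<Prod>t\<in>set (triangles T). ?f t)"
    by (simp add: prod_uminus distinct_card[OF distinct_triangles[OF assms(1)]])
  finally show ?thesis
    unfolding amplitude_eq[OF assms] using assms(2) by (simp add: power_add)
qed

lemma amplitude_homogeneous:
  assumes "is_two_tree T" "n = length T + 3" "generic T s" "t \<noteq> 0"
  shows "amplitude n T (\<lambda>e. t * s e) = t powi (3 - int n) * amplitude n T s"
proof -
  have gen: "generic T (\<lambda>e. t * s e)"
    using assms(3,4) by (auto simp: generic_def bracket_scale simp flip: distrib_left)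
  let ?f = "\<lambda>(i, j, k). - (bracket T s (i, k) + bracket T s (j, k)) / (bracket T s (i, k) * bracket T s (j, k))"
  have "amplitude n T (\<lambda>e. t * s e) = - (\<Prod>u\<in>set (triangles T). inverse t * ?f u)"
    unfolding amplitude_eq[OF assms(1,2) gen] bracket_scale
    by (intro arg_cong[of _ _ uminus] prod.cong)
      (use assms(4) in \<open>auto simp: divide_simps simp flip: distrib_left minus_mult_right\<close>)
  also have "\<dots> = inverse t ^ length T * amplitude n T s"
    unfolding amplitude_eq[OF assms(1-3)]
    by (simp add: prod.distrib distinct_card[OF distinct_triangles[OF assms(1)]])
  also have "inverse t ^ length T = t powi (3 - int n)"
    using assms(2) by (simp add: power_int_minus power_inverse)
  finally show ?thesis .
qed

section \<open>The Horn matrix\<close>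

lemma horn_dims [simp]: "dim_row (horn T) = 3 * length T" "dim_col (horn T) = 2 * length T"
  using horn_carrier[of T] by auto

lemma horn_base_entries:
  "horn_base \<in> carrier_mat 3 2"
  "horn_base $$ (0, 0) = 1" "horn_base $$ (0, Suc 0) = 0"
  "horn_base $$ (Suc 0, 0) = 0" "horn_base $$ (Suc 0, Suc 0) = 1"
  "horn_base $$ (2, 0) = - 1" "horn_base $$ (2, Suc 0) = - 1"
  by (auto simp: horn_base_def mat_of_rows_list_def)

text \<open>The recursion extends to the single edge, where the Horn matrix has no rows and no columns.\<close>

lemma horn_attach:
  "horn (e # T) = four_block_mat (horn T)
    (mat_of_cols (3 * length T) [edge_col T (horn T) e, edge_col T (horn T) e])
    (0\<^sub>m 3 (2 * length T)) horn_base"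
proof (cases T)
  case Nil
  then show ?thesis using horn_base_entries(1) by (intro eq_matI) auto
next
  case (Cons f S)
  then show ?thesis using horn_dims[of T] by (simp add: Let_def)
qed

lemma horn_form_sum:
  assumes "r < 3 * length T"
  shows "horn_form T r s = (\<Sum>c<2 * length T. horn T $$ (r, c) * s (edges T ! c))"
proof -
  have "dim_vec (vec_of_list (map s (edges T))) = 2 * length T" by simp
  then have "horn_form T r s =
      (\<Sum>c<2 * length T. Matrix.row (horn T) r $ c * vec_of_list (map s (edges T)) $ c)"
    using assms by (simp add: horn_form_def scalar_prod_def atLeast0LessThan)
  also have "\<dots> = (\<Sum>c<2 * length T. horn T $$ (r, c) * s (edges T ! c))"
    by (rule sum.cong) (use assms in \<open>auto simp: vec_of_list_index\<close>)
  finally show ?thesis .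
qed

lemma edge_index:
  assumes "e \<in> set (edges T)"
  defines "p \<equiv> length (takeWhile (\<lambda>f. f \<noteq> e) (edges T))"
  shows "p < 2 * length T" "edges T ! p = e"
proof -
  have "takeWhile (\<lambda>f. f \<noteq> e) (edges T) \<noteq> edges T"
    using assms(1) set_takeWhileD[of e "\<lambda>f. f \<noteq> e" "edges T"] by auto
  then have "\<not> length (edges T) \<le> p"
    using takeWhile_eq_take[of "\<lambda>f. f \<noteq> e" "edges T"] by (auto simp: p_def)
  then show "p < 2 * length T" "edges T ! p = e"
    using nth_length_takeWhile[of "\<lambda>f. f \<noteq> e" "edges T"] by (simp_all add: p_def)
qed

text \<open>In the upper rows the columns of the new edges repeat the column of \<open>ij\<close>, which multiplies
  \<open>s\<^sub>i\<^sub>j + s\<^sub>i\<^sub>k + s\<^sub>j\<^sub>k\<close>.  For the edge 12 these columns vanish, and contraction to 12 discards the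
  weights.\<close>

lemma horn_form_attach_upper:
  assumes "is_two_tree T" "(i, j) \<in> insert (1, 2) (set (edges T))" "r < 3 * length T"
  shows "horn_form ((i, j) # T) r s = horn_form T r (contract (i, j) (length T + 3) s)"
proof -
  let ?m = "length T + 3" and ?H = "horn T" and ?L = "2 * length T" and ?h = "edge_col T (horn T) (i, j)"
  let ?S = "s (i, ?m) + s (j, ?m)"
  have entry: "horn ((i, j) # T) $$ (r, c) = (if c < ?L then ?H $$ (r, c) else vec_index ?h r)"
    if "c < ?L + 2" for c
    using that assms(3) horn_base_entries(1)
    by (auto simp: horn_attach mat_of_cols_index less_Suc_eq nth_Cons')
  have "horn_form ((i, j) # T) r s =
      (\<Sum>c<Suc (Suc ?L). horn ((i, j) # T) $$ (r, c) * s (edges ((i, j) # T) ! c))"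
    using horn_form_sum[of r "(i, j) # T" s] assms(3) by simp
  also have "\<dots> = (\<Sum>c<?L. ?H $$ (r, c) * s (edges T ! c)) + vec_index ?h r * ?S"
    by (simp add: entry nth_append algebra_simps)
  also have "vec_index ?h r * ?S = (\<Sum>c<?L. if edges T ! c = (i, j) then ?H $$ (r, c) * ?S else 0)"
  proof (cases "(i, j) = (1, 2)")
    case True
    have "edges T ! c \<noteq> (1, 2)" if "c < ?L" for c
      using that root_notin_edges[OF assms(1), of 1] by (metis length_edges nth_mem)
    then show ?thesis using True assms(3) by (simp add: edge_col_def)
  next
    case False
    define p where "p = length (takeWhile (\<lambda>f. f \<noteq> (i, j)) (edges T))"
    have p: "p < ?L" "edges T ! p = (i, j)"
      using edge_index[of "(i, j)" T] False assms(2) by (auto simp: p_def)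
    have "edges T ! c = (i, j) \<longleftrightarrow> c = p" if "c < ?L" for c
      using nth_eq_iff_index_eq[OF distinct_edges[OF assms(1)], of c p] p that by simp
    then have "(\<Sum>c<?L. if edges T ! c = (i, j) then ?H $$ (r, c) * ?S else 0) =
        (\<Sum>c<?L. if c = p then ?H $$ (r, p) * ?S else 0)"
      by (intro sum.cong) auto
    also have "\<dots> = ?H $$ (r, p) * ?S" using p by simp
    finally have "(\<Sum>c<?L. if edges T ! c = (i, j) then ?H $$ (r, c) * ?S else 0) = ?H $$ (r, p) * ?S" .
    moreover have "?h = col ?H p"
      unfolding edge_col_def p_def using False by (rule if_not_P)
    ultimately show ?thesis using p assms(3) by simp
  qed
  also have "(\<Sum>c<?L. ?H $$ (r, c) * s (edges T ! c)) + \<dots> =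
      (\<Sum>c<?L. ?H $$ (r, c) * contract (i, j) ?m s (edges T ! c))"
    unfolding sum.distrib[symmetric] by (rule sum.cong) (auto simp: contract_def algebra_simps)
  also have "\<dots> = horn_form T r (contract (i, j) ?m s)"
    using horn_form_sum[OF assms(3)] by simp
  finally show ?thesis .
qed

lemma horn_form_attach_lower:
  assumes "r < 3"
  shows "horn_form ((i, j) # T) (3 * length T + r) s =
    horn_base $$ (r, 0) * s (i, length T + 3) + horn_base $$ (r, 1) * s (j, length T + 3)"
proof -
  let ?L = "2 * length T" and ?r = "3 * length T + r"
  have entry: "horn ((i, j) # T) $$ (?r, c) = (if c < ?L then 0 else horn_base $$ (r, c - ?L))"
    if "c < ?L + 2" for c
    using that assms horn_base_entries(1) by (auto simp: horn_attach)
  have "horn_form ((i, j) # T) ?r s =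
      (\<Sum>c<Suc (Suc ?L). horn ((i, j) # T) $$ (?r, c) * s (edges ((i, j) # T) ! c))"
    using horn_form_sum[of ?r "(i, j) # T" s] assms by simp
  also have "\<dots> = horn_base $$ (r, 0) * s (i, length T + 3) + horn_base $$ (r, 1) * s (j, length T + 3)"
    by (simp add: entry nth_append)
  finally show ?thesis .
qed

lemma horn_form_brackets:
  assumes "is_two_tree T" "q < length T" "triangles T ! q = (i, j, k)"
  shows "horn_form T (3 * q) s = bracket T s (i, k)"
    "horn_form T (3 * q + 1) s = bracket T s (j, k)"
    "horn_form T (3 * q + 2) s = - (bracket T s (i, k) + bracket T s (j, k))"
proof -
  have "horn_form T (3 * q) s = bracket T s (i, k) \<and> horn_form T (3 * q + 1) s = bracket T s (j, k) \<and>
      horn_form T (3 * q + 2) s = - (bracket T s (i, k) + bracket T s (j, k))"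
    using assms
  proof (induction arbitrary: s q rule: two_tree_induct)
    case edge
    then show ?case by simp
  next
    case (attach i' j' T)
    show ?case
    proof (cases "q = length T")
      case True
      then have ijk: "i = i'" "j = j'" "k = length T + 3" using attach.prems by (auto simp: nth_append)
      have *: "bracket ((i', j') # T) s (i, k) = s (i, k)" "bracket ((i', j') # T) s (j, k) = s (j, k)"
        using bracket_last[OF attach.hyps(1,3-5)] by (simp_all add: ijk)
      show ?thesis
        using horn_form_attach_lower[of 0 i' j' T s] horn_form_attach_lower[of 1 i' j' T s]
          horn_form_attach_lower[of 2 i' j' T s] *
        by (simp add: True horn_base_entries ijk)
    next
      case False
      then have q: "q < length T" "triangles T ! q = (i, j, k)" using attach.prems by (auto simp: nth_append)
      then have "(i, j, k) \<in> set (triangles T)" by (metis length_triangles nth_mem)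
      from triangle_brackets_contract[OF attach.hyps(1-5) this, of s] attach.IH[OF q]
      show ?thesis
        using q(1) by (simp add: horn_form_attach_upper[OF attach.hyps(1,2)])
    qed
  qed
  then show "horn_form T (3 * q) s = bracket T s (i, k)"
    "horn_form T (3 * q + 1) s = bracket T s (j, k)"
    "horn_form T (3 * q + 2) s = - (bracket T s (i, k) + bracket T s (j, k))" by auto
qed

lemma amplitude_horn_forms:
  assumes "is_two_tree T" "n = length T + 3" "generic T s"
  shows "amplitude n T s = - (\<Prod>q<length T. horn_form T (3 * q + 2) s) /
    ((\<Prod>q<length T. horn_form T (3 * q) s) * (\<Prod>q<length T. horn_form T (3 * q + 1) s))"
proof -
  have "(\<Prod>(i, j, k)\<in>set (triangles T).
      - (bracket T s (i, k) + bracket T s (j, k)) / (bracket T s (i, k) * bracket T s (j, k))) =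
      (\<Prod>q<length T. case triangles T ! q of (i, j, k) \<Rightarrow>
        - (bracket T s (i, k) + bracket T s (j, k)) / (bracket T s (i, k) * bracket T s (j, k)))"
    unfolding prod.distinct_set_conv_list[OF distinct_triangles[OF assms(1)]]
    by (simp add: prod.list_conv_set_nth atLeast0LessThan)
  also have "\<dots> = (\<Prod>q<length T. horn_form T (3 * q + 2) s / (horn_form T (3 * q) s * horn_form T (3 * q + 1) s))"
    by (rule prod.cong) (use horn_form_brackets[OF assms(1), of _ _ _ _ s] in \<open>auto split: prod.split\<close>)
  finally show ?thesis
    unfolding amplitude_eq[OF assms] by (simp add: prod_dividef prod.distrib)
qed

theorem theorem4p1:
  fixes n :: nat and T :: two_tree
  assumes "n \<ge> 4" and "two_tree_on (n - 1) T"
  shows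
    "(\<forall>s. generic T s \<longrightarrow>
        (\<exists>!x. critical_point n T s x) \<and>
        amplitude n T s = (-1) ^ n *
          (\<Prod>(i, j, k)\<in>set (triangles T).
             (bracket T s (i, k) + bracket T s (j, k)) /
             (bracket T s (i, k) * bracket T s (j, k))) \<and>
        (\<forall>t. t \<noteq> 0 \<longrightarrow> amplitude n T (\<lambda>e. t * s e) = t powi (3 - int n) * amplitude n T s))
     \<and> (\<exists>A \<subseteq> {..<3 * n - 9}. card A = n - 3 \<and> card ({..<3 * n - 9} - A) = 2 * n - 6 \<and>
          (\<forall>s. generic T s \<longrightarrow>
             amplitude n T s =
               - (\<Prod>r\<in>A. horn_form T r s) / (\<Prod>r\<in>{..<3 * n - 9} - A. horn_form T r s)))"
proof -
  have T: "is_two_tree T" and n: "n = length T + 3"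
    using assms by (auto simp: two_tree_on_def)
  define A B C where "A = (\<lambda>q. 3 * q + 2) ` {..<length T}" and "B = (\<lambda>q. 3 * q) ` {..<length T}"
    and "C = (\<lambda>q. 3 * q + 1) ` {..<length T}"
  have inj: "inj_on (\<lambda>q. 3 * q + 2) {..<length T}" "inj_on (\<lambda>q. 3 * q) {..<length T}"
    "inj_on (\<lambda>q. 3 * q + 1) {..<length T}" by (auto simp: inj_on_def)
  have sub: "A \<subseteq> {..<3 * n - 9}" using n by (auto simp: A_def)
  have card: "card A = length T" using card_image[OF inj(1)] by (simp add: A_def)
  have compl: "{..<3 * n - 9} - A = B \<union> C"
  proof
    show "B \<union> C \<subseteq> {..<3 * n - 9} - A" using n by (auto simp: A_def B_def C_def) presburger+
    show "{..<3 * n - 9} - A \<subseteq> B \<union> C"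
    proof
      fix r assume r: "r \<in> {..<3 * n - 9} - A"
      define q where "q = r div 3"
      have q: "q < length T" "r = 3 * q \<or> r = 3 * q + 1 \<or> r = 3 * q + 2"
        using r n unfolding q_def by auto
      then show "r \<in> B \<union> C" using r by (auto simp: A_def B_def C_def)
    qed
  qed
  have disj: "B \<inter> C = {}" unfolding B_def C_def by auto presburger
  have "card ({..<3 * n - 9} - A) = 2 * n - 6"
    using card_Diff_subset[OF _ sub] card n by (simp add: A_def)
  moreover have "amplitude n T s =
      - (\<Prod>r\<in>A. horn_form T r s) / (\<Prod>r\<in>{..<3 * n - 9} - A. horn_form T r s)"
    if "generic T s" for s
  proof -
    have "(\<Prod>r\<in>A. horn_form T r s) = (\<Prod>q<length T. horn_form T (3 * q + 2) s)"
      "(\<Prod>r\<in>B. horn_form T r s) = (\<Prod>q<length T. horn_form T (3 * q) s)"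
      "(\<Prod>r\<in>C. horn_form T r s) = (\<Prod>q<length T. horn_form T (3 * q + 1) s)"
      unfolding A_def B_def C_def using inj by (simp_all add: prod.reindex)
    moreover have "(\<Prod>r\<in>B \<union> C. horn_form T r s) = (\<Prod>r\<in>B. horn_form T r s) * (\<Prod>r\<in>C. horn_form T r s)"
      by (rule prod.union_disjoint[OF _ _ disj]) (auto simp: B_def C_def)
    ultimately show ?thesis unfolding compl amplitude_horn_forms[OF T n that] by simp
  qed
  ultimately show ?thesis
    using sub card n
    by (intro conjI allI impI exI[of _ A] critical_point_unique[OF T n] amplitude_signed[OF T n]
        amplitude_homogeneous[OF T n]) simp_all
qed

end
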